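(* Let $r,s$ be positive integers and $\eta=r+s$. Let $\boldsymbol{s}=(s_{ij})\in W^{\mathrm{diag}}_{(s^r)}$ and $\boldsymbol{t}=(t_{ij})\in W^{\mathrm{diag}}_{(r^s)}$, and write $a_k=s_{i,i+k}$ and $b_k=t_{i,i+k}$ for $k\in\mathbb{Z}$. Assume moreover that $\Re(s_{ij})>1$ for all $1\le i\le r$, $1\le j\le s$ and $\Re(t_{ij})>1$ for all $1\le i\le s$, $1\le j\le r$. Then $$\sum_{\lambda\subset(s^r)}(-1)^{|\lambda|}\zeta_\lambda(\boldsymbol{s}|_\lambda)\,\zeta_{\lambda^*}(\boldsymbol{t}|_{\lambda^*})=\det\begin{bmatrix}P\\ Q\end{bmatrix},$$ where $P=[P_{ij}]_{1\le i\le r,\,1\le j\le\eta}$ and $Q=[Q_{ij}]_{1\le i\le s,\,1\le j\le\eta}$ (stacked with $P$ on top of $Q$) are given by $$P_{ij}=\begin{cases}\zeta^\star(a_{i-r},a_{i+1-r},\ldots,a_{j-1-r})& i<j,\\1& i=j,\\0& i>j,\end{cases}\qquad Q_{ij}=\begin{cases}\zeta^\star(b_{i-s},b_{i+1-s},\ldots,b_{j-1-s})& i<j,\\1& i=j,\\0& i>j.\end{cases}$$ Here $\boldsymbol{s}|_\lambda$ and $\boldsymbol{t}|_{\lambda^*}$ are the restrictions of the fillings $\boldsymbol{s}$ and $\boldsymbol{t}$ to the shapes $\lambda\subset(s^r)$ and $\lambda^*\subset(r^s)$.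
   Context: $(s^r)$ denotes the partition with $r$ parts equal to $s$. The sum is over all partitions $\lambda=(\lambda_1,\ldots,\lambda_r)$ (zero parts allowed) with $\lambda_i\le s$, and $\lambda^*=(r-\lambda'_s,\ldots,r-\lambda'_1)$, where $\lambda'=(\lambda'_1,\ldots,\lambda'_s)$, $\lambda'_i=\#\{j:\lambda_j\ge i\}$ (zero parts allowed), is the conjugate. $|\lambda|=\sum\lambda_i$. $\zeta^{\star}(s_1,\ldots,s_n)=\sum_{0<m_1\le\cdots\le m_n}\prod_i m_i^{-s_i}$. For a partition $\lambda$, $D(\lambda)=\{(i,j):1\le j\le\lambda_i\}$; $C(\lambda)$ is the set of corners, i.e. $(i,j)\in D(\lambda)$ with $(i+1,j),(i,j+1)\notin D(\lambda)$; $T(\lambda,X)$ is the set of fillings of $D(\lambda)$ by elements of $X$; $T^{\mathrm{diag}}(\lambda,X)$ is the subset with $t_{ij}=t_{kl}$ whenever $j-i=l-k$; $\mathrm{SSYT}(\lambda)$ is the set of semi-standard fillings by positive integers (rows weakly increasing, columns strictly increasing). For $\boldsymbol{s}\in T(\lambda,\mathbb{C})$, $\zeta_\lambda(\boldsymbol{s})=\sum_{(m_{ij})\in\mathrm{SSYT}(\lambda)}\prod_{(i,j)\in D(\lambda)}m_{ij}^{-s_{ij}}$, and $\zeta_\emptyset=1$. $W_\lambda$ is the set of $\boldsymbol{s}\in T(\lambda,\mathbb{C})$ with $\Re(s_{ij})\ge1$ for $(i,j)\in D(\lambda)\setminus C(\lambda)$ and $\Re(s_{ij})>1$ for $(i,j)\in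 C(\lambda)$; $W^{\mathrm{diag}}_\lambda=W_\lambda\cap T^{\mathrm{diag}}(\lambda,\mathbb{C})$. *)

theory Defs
  imports "HOL-Analysis.Analysis" "Jordan_Normal_Form.Determinant"
begin

text \<open>
  Partitions are weakly decreasing lists of natural numbers, zero parts allowed.
  Boxes of Young diagrams are indexed from 1, whereas lists are indexed from 0.
\<close>

definition rect :: "nat \<Rightarrow> nat \<Rightarrow> nat list" where
  "rect s r = replicate r s"

definition partitions_in_rect :: "nat \<Rightarrow> nat \<Rightarrow> nat list set" where
  "partitions_in_rect s r =
     {l. length l = r \<and> sorted_wrt (\<ge>) l \<and> (\<forall>x\<in>set l. x \<le> s)}"

definition conj_part :: "nat list \<Rightarrow> nat \<Rightarrow> nat" where
  "conj_part l i = card {j. j < length l \<and> i \<le> l ! j}"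

text \<open>
  The list \<open>(r - \<lambda>'\<^sub>s, \<dots>, r - \<lambda>'\<^sub>1)\<close>; for a partition inside the \<open>r \<times> s\<close> rectangle
  no subtraction is truncated.
\<close>

definition dual_partition :: "nat \<Rightarrow> nat \<Rightarrow> nat list \<Rightarrow> nat list" where
  "dual_partition s r l = map (\<lambda>i. r - conj_part l i) (rev [1..<Suc s])"

definition diagram :: "nat list \<Rightarrow> (nat \<times> nat) set" where
  "diagram l = {(i, j). 1 \<le> i \<and> i \<le> length l \<and> 1 \<le> j \<and> j \<le> l ! (i - 1)}"

definition corners :: "nat list \<Rightarrow> (nat \<times> nat) set" where
  "corners l =
     {(i, j). (i, j) \<in> diagram l \<and> (i + 1, j) \<notin> diagram l \<and> (i, j + 1) \<notin> diagram l}"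

definition fillings :: "nat list \<Rightarrow> 'a set \<Rightarrow> (nat \<times> nat \<Rightarrow> 'a) set" where
  "fillings l X = (diagram l \<rightarrow>\<^sub>E X)"

definition fillings_diag :: "nat list \<Rightarrow> 'a set \<Rightarrow> (nat \<times> nat \<Rightarrow> 'a) set" where
  "fillings_diag l X =
     {t \<in> fillings l X. \<forall>(i, j) \<in> diagram l. \<forall>(k, m) \<in> diagram l.
        int j - int i = int m - int k \<longrightarrow> t (i, j) = t (k, m)}"

definition SSYT :: "nat list \<Rightarrow> (nat \<times> nat \<Rightarrow> nat) set" where
  "SSYT l =
     {m \<in> fillings l {1..}.
        (\<forall>i j. (i, j) \<in> diagram l \<and> (i, j + 1) \<in> diagram l \<longrightarrow> m (i, j) \<le> m (i, j + 1)) \<and>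
        (\<forall>i j. (i, j) \<in> diagram l \<and> (i + 1, j) \<in> diagram l \<longrightarrow> m (i, j) < m (i + 1, j))}"

text \<open>
  For the empty diagram there is exactly one (empty) tableau and the product is empty,
  so the value is 1.
\<close>

definition schur_zeta :: "nat list \<Rightarrow> (nat \<times> nat \<Rightarrow> complex) \<Rightarrow> complex" where
  "schur_zeta l s =
     (\<Sum>\<^sub>\<infinity>m\<in>SSYT l. \<Prod>p\<in>diagram l. of_nat (m p) powr (- s p))"

definition zeta_star :: "complex list \<Rightarrow> complex" where
  "zeta_star ss =
     (\<Sum>\<^sub>\<infinity>ms\<in>{ms. length ms = length ss \<and> (\<forall>m\<in>set ms. 0 < m) \<and> sorted ms}.
        \<Prod>i<length ss. of_nat (ms ! i) powr (- (ss ! i)))"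

definition W :: "nat list \<Rightarrow> (nat \<times> nat \<Rightarrow> complex) set" where
  "W l =
     {s \<in> fillings l UNIV.
        (\<forall>p \<in> diagram l - corners l. Re (s p) \<ge> 1) \<and> (\<forall>p \<in> corners l. Re (s p) > 1)}"

definition W_diag :: "nat list \<Rightarrow> (nat \<times> nat \<Rightarrow> complex) set" where
  "W_diag l = W l \<inter> fillings_diag l UNIV"

text \<open>
  The entries of the blocks \<open>P\<close> (with \<open>p = r\<close>) and \<open>Q\<close> (with \<open>p = s\<close>), with indices
  starting at 1; \<open>c k\<close> is the common value of the filling on the diagonal \<open>j - i = k\<close>.
\<close>

definition block_entry :: "nat \<Rightarrow> (int \<Rightarrow> complex) \<Rightarrow> nat \<Rightarrow> nat \<Rightarrow> complex" where
  "block_entry p c i j =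
     (if i < j then zeta_star (map c [int i - int p..int j - 1 - int p])
      else if i = j then 1 else 0)"

text \<open>Matrix indices start at 0, hence the shift by one.\<close>

definition block :: "nat \<Rightarrow> nat \<Rightarrow> (int \<Rightarrow> complex) \<Rightarrow> complex mat" where
  "block p n c = mat p n (\<lambda>(i, j). block_entry p c (i + 1) (j + 1))"

end

theory Submission
  imports Defs
begin

text \<open>
  The proof reads the determinant of the stacked matrix as a sum over partitions by Laplace
  expansion along its first \<open>r\<close> rows, and then recognises every minor as a Schur multiple zeta
  value by a Jacobi-Trudi formula.

  \<^bold>\<open>Laplace expansion.\<close>  The expansion runs over the \<open>r\<close>-element sets of columns that go to the
  upper block.  Such a set is listed increasingly as \<open>\<lambda>\<^sub>r < \<lambda>\<^sub>r\<^sub>-\<^sub>1 + 1 < \<dots> < \<lambda>\<^sub>1 + r - 1\<close> for a unique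
  partition \<open>\<lambda>\<close> inside the \<open>r \<times> s\<close> rectangle (\<open>beta_num\<close>), and the complementary columns are the
  numbers attached in the same way to the dual partition \<open>\<lambda>\<^sup>*\<close>.  Adding a box to \<open>\<lambda>\<close> exchanges one
  chosen column with the neighbouring column that was not chosen, so the sign of the term is
  \<open>(-1)\<close> to the number of boxes (\<open>sign_shuffle_perm\<close>, \<open>laplace_expansion_rows\<close>).

  \<^bold>\<open>Jacobi-Trudi.\<close>  The minor of the upper block on the columns of \<open>\<lambda>\<close> is \<open>\<zeta>\<^sub>\<lambda>\<close>.  It is enough to
  show this for finite truncations, where it holds for arbitrary weights \<open>x\<^sub>k(m)\<close> depending on the
  content \<open>k\<close> and the entry \<open>m\<close> of a box, and it is best to truncate each row \<open>i\<close> at a bound \<open>f i\<close>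
  of its own, with \<open>f\<close> weakly increasing.  Then the bounds can be lowered one at a time.  On the side
  of tableaux, the last box of the row either does not attain the bound, or it can be removed; on the
  side of determinants, the star sum \<open>h\<^sub>N(l, u)\<close> over the contents \<open>l, \<dots>, u - 1\<close>, truncated at \<open>N\<close>, satisfies
  \<open>h\<^sub>N(l, u) = h\<^sub>N\<^sub>-\<^sub>1(l, u) + x\<^sub>u\<^sub>-\<^sub>1(N) h\<^sub>N(l, u - 1)\<close> (\<open>star_sum_Suc\<close>) and a determinant is linear in
  a row.  If the row is the topmost one among those with the largest bound, the two recursions agree,
  and where the last box is not a corner the extra determinant vanishes (\<open>flagged_jacobi_trudi\<close>).

  \<^bold>\<open>Limit.\<close>  Since all exponents have real part greater than one, the series are dominated by products
  of convergent zeta series, one for each box or summation index.  They converge absolutely, and the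
  truncated formula passes to the limit entry by entry (\<open>schur_zeta_jacobi_trudi\<close>).
\<close>

section \<open>Truncated star sums\<close>

definition star_seqs :: "nat \<Rightarrow> nat \<Rightarrow> nat list set" where
  "star_seqs n N = {ms. length ms = n \<and> (\<forall>m\<in>set ms. 0 < m \<and> m \<le> N) \<and> sorted ms}"

text \<open>
  The weight of the \<open>i\<close>-th summation index is \<open>x (l + i)\<close>, so the weights used are those of the
  contents in the half-open interval from \<open>l\<close> to \<open>u\<close>.  The value 0 for \<open>u < l\<close> gives the zeros of the
  Jacobi-Trudi matrix and keeps the recursion below valid for all \<open>l\<close> and \<open>u\<close>.
\<close>

definition star_sum :: "(int \<Rightarrow> nat \<Rightarrow> 'a::comm_ring_1) \<Rightarrow> nat \<Rightarrow> int \<Rightarrow> int \<Rightarrow> 'a" where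
  "star_sum x N l u =
     (if u < l then 0
      else \<Sum>ms\<in>star_seqs (nat (u - l)) N. \<Prod>i<nat (u - l). x (l + int i) (ms ! i))"

lemma finite_star_seqs: "finite (star_seqs n N)"
proof (rule finite_subset)
  show "star_seqs n N \<subseteq> {ms. set ms \<subseteq> {..N} \<and> length ms = n}"
    by (auto simp: star_seqs_def)
qed (simp add: finite_lists_length_eq)

lemma star_seqs_0 [simp]: "star_seqs 0 N = {[]}"
  by (auto simp: star_seqs_def)

lemma star_seqs_Suc_0 [simp]: "star_seqs (Suc n) 0 = {}"
  by (auto simp: star_seqs_def length_Suc_conv)

lemma star_seqs_Suc_Suc:
  "star_seqs (Suc n) (Suc N) =
     star_seqs (Suc n) N \<union> (\<lambda>ms. ms @ [Suc N]) ` star_seqs n (Suc N)"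
proof (intro equalityI subsetI)
  fix ms assume ms: "ms \<in> star_seqs (Suc n) (Suc N)"
  then obtain ks k where [simp]: "ms = ks @ [k]"
    by (cases ms rule: rev_cases) (auto simp: star_seqs_def)
  show "ms \<in> star_seqs (Suc n) N \<union> (\<lambda>ms. ms @ [Suc N]) ` star_seqs n (Suc N)"
    using ms by (cases "k = Suc N") (fastforce simp: star_seqs_def sorted_append)+
qed (auto simp: star_seqs_def sorted_append)

lemma star_sum_same [simp]: "star_sum x N l l = 1"
  by (simp add: star_sum_def)

lemma star_sum_less: "u < l \<Longrightarrow> star_sum x N l u = 0"
  by (simp add: star_sum_def)

lemma star_sum_bound_0: "star_sum x 0 l u = (if l = u then 1 else 0)"
  by (cases "nat (u - l)") (auto simp: star_sum_def)

text \<open>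
  A weakly increasing sequence bounded by \<open>N + 1\<close> either is bounded by \<open>N\<close> or ends in \<open>N + 1\<close>;
  dropping this last term leaves a sequence which may still take the value \<open>N + 1\<close>.
\<close>

lemma star_sum_Suc:
  "star_sum x (Suc N) l u =
     star_sum x N l u + x (u - 1) (Suc N) * star_sum x (Suc N) l (u - 1)"
proof (cases "l < u")
  case False
  then show ?thesis by (cases "l = u") (auto simp: star_sum_less)
next
  case True
  then obtain n where n: "nat (u - l) = Suc n" "nat (u - 1 - l) = n" "u - 1 = l + int n"
    by (intro that[of "nat (u - 1 - l)"]) auto
  let ?w = "\<lambda>n ms. \<Prod>i<n. x (l + int i) (ms ! i)"
  have "star_sum x (Suc N) l u = (\<Sum>ms\<in>star_seqs (Suc n) (Suc N). ?w (Suc n) ms)"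
    using True n by (simp add: star_sum_def)
  also have "\<dots> = (\<Sum>ms\<in>star_seqs (Suc n) N. ?w (Suc n) ms) +
      (\<Sum>ms\<in>(\<lambda>ms. ms @ [Suc N]) ` star_seqs n (Suc N). ?w (Suc n) ms)"
    unfolding star_seqs_Suc_Suc
    by (rule sum.union_disjoint) (use finite_star_seqs in \<open>auto simp: star_seqs_def\<close>)
  also have "(\<Sum>ms\<in>(\<lambda>ms. ms @ [Suc N]) ` star_seqs n (Suc N). ?w (Suc n) ms) =
      (\<Sum>ms\<in>star_seqs n (Suc N). x (u - 1) (Suc N) * ?w n ms)"
    unfolding n(3)
    by (subst sum.reindex) (auto simp: inj_on_def star_seqs_def nth_append mult.commute
      intro!: sum.cong)
  finally show ?thesis
    using True n by (simp add: star_sum_def sum_distrib_left)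
qed

section \<open>Flagged semi-standard tableaux\<close>

text \<open>
  The bound \<open>f\<close> is indexed from 0, like the parts of \<open>l\<close>, whereas the rows of the diagram are indexed
  from 1.
\<close>

definition flagged_SSYT :: "nat list \<Rightarrow> (nat \<Rightarrow> nat) \<Rightarrow> (nat \<times> nat \<Rightarrow> nat) set" where
  "flagged_SSYT l f = {m \<in> SSYT l. \<forall>(i, j) \<in> diagram l. m (i, j) \<le> f (i - 1)}"

definition flagged_schur ::
  "(int \<Rightarrow> nat \<Rightarrow> 'a::comm_ring_1) \<Rightarrow> nat list \<Rightarrow> (nat \<Rightarrow> nat) \<Rightarrow> 'a" where
  "flagged_schur x l f =
     (\<Sum>m\<in>flagged_SSYT l f. \<Prod>(i, j)\<in>diagram l. x (int j - int i) (m (i, j)))"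

lemma finite_diagram: "finite (diagram l)"
proof (rule finite_subset)
  show "diagram l \<subseteq> {..length l} \<times> {..sum_list l}"
    by (auto simp: diagram_def intro: order_trans[OF _ elem_le_sum_list])
qed simp

lemma SSYT_D:
  assumes "m \<in> SSYT l"
  shows "p \<in> diagram l \<Longrightarrow> 1 \<le> m p"
    and "p \<notin> diagram l \<Longrightarrow> m p = undefined"
    and "(i, j) \<in> diagram l \<Longrightarrow> (i, j + 1) \<in> diagram l \<Longrightarrow> m (i, j) \<le> m (i, j + 1)"
    and "(i, j) \<in> diagram l \<Longrightarrow> (i + 1, j) \<in> diagram l \<Longrightarrow> m (i, j) < m (i + 1, j)"
proof -
  have fil: "m \<in> diagram l \<rightarrow>\<^sub>E {1..}" and
    rowcol: "\<And>i j. (i, j) \<in> diagram l \<Longrightarrow> (i, j + 1) \<in> diagram l \<Longrightarrow> m (i, j) \<le> m (i, j + 1)"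
    "\<And>i j. (i, j) \<in> diagram l \<Longrightarrow> (i + 1, j) \<in> diagram l \<Longrightarrow> m (i, j) < m (i + 1, j)"
    using assms unfolding SSYT_def fillings_def by blast+
  show "p \<in> diagram l \<Longrightarrow> 1 \<le> m p" "p \<notin> diagram l \<Longrightarrow> m p = undefined"
    using PiE_mem[OF fil] PiE_arb[OF fil] by auto
  show "(i, j) \<in> diagram l \<Longrightarrow> (i, j + 1) \<in> diagram l \<Longrightarrow> m (i, j) \<le> m (i, j + 1)"
    "(i, j) \<in> diagram l \<Longrightarrow> (i + 1, j) \<in> diagram l \<Longrightarrow> m (i, j) < m (i + 1, j)"
    by (fact rowcol)+
qed

lemma SSYT_I:
  assumes "\<And>p. p \<in> diagram l \<Longrightarrow> 1 \<le> m p" "\<And>p. p \<notin> diagram l \<Longrightarrow> m p = undefined"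
    and "\<And>i j. (i, j) \<in> diagram l \<Longrightarrow> (i, j + 1) \<in> diagram l \<Longrightarrow> m (i, j) \<le> m (i, j + 1)"
    and "\<And>i j. (i, j) \<in> diagram l \<Longrightarrow> (i + 1, j) \<in> diagram l \<Longrightarrow> m (i, j) < m (i + 1, j)"
  shows "m \<in> SSYT l"
  unfolding SSYT_def fillings_def mem_Collect_eq
proof (intro conjI)
  show "m \<in> diagram l \<rightarrow>\<^sub>E {1..}"
    by (rule PiE_I) (use assms(1,2) in auto)
qed (use assms(3,4) in blast)+

lemma flagged_SSYT_D:
  assumes "m \<in> flagged_SSYT l f"
  shows "m \<in> SSYT l" and "(i, j) \<in> diagram l \<Longrightarrow> m (i, j) \<le> f (i - 1)"
  using assms unfolding flagged_SSYT_def by blast+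

lemma flagged_SSYT_I:
  assumes "m \<in> SSYT l" "\<And>i j. (i, j) \<in> diagram l \<Longrightarrow> m (i, j) \<le> f (i - 1)"
  shows "m \<in> flagged_SSYT l f"
  using assms unfolding flagged_SSYT_def by blast

lemma finite_flagged_SSYT: "finite (flagged_SSYT l f)"
proof (rule finite_subset)
  show "flagged_SSYT l f \<subseteq> (\<Pi>\<^sub>E p\<in>diagram l. {..f (fst p - 1)})"
    by (intro subsetI PiE_I) (auto dest: flagged_SSYT_D SSYT_D)
qed (simp add: finite_PiE finite_diagram)

lemma SSYT_row_mono:
  assumes "m \<in> SSYT l" "(i, k) \<in> diagram l" "1 \<le> j" "j \<le> k"
  shows "m (i, j) \<le> m (i, k)"
  using assms(4,2)
proof (induction k rule: dec_induct)
  case (step n)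
  then have "(i, n) \<in> diagram l" "(i, n + 1) \<in> diagram l"
    using assms(3) by (auto simp: diagram_def)
  then show ?case using step SSYT_D(3)[OF assms(1), of i n] by simp
qed simp

lemma diagram_remove_box:
  assumes "i < length l" "0 < l ! i"
  shows "diagram l = insert (Suc i, l ! i) (diagram (l[i := l ! i - 1]))"
    and "(Suc i, l ! i) \<notin> diagram (l[i := l ! i - 1])"
  using assms by (auto simp: diagram_def nth_list_update split: if_splits)

lemma prod_diagram_remove_box:
  assumes "i < length l" "0 < l ! i"
  shows "(\<Prod>p\<in>diagram l. g p) = g (Suc i, l ! i) * (\<Prod>p\<in>diagram (l[i := l ! i - 1]). g p)"
  unfolding diagram_remove_box(1)[OF assms]
  by (rule prod.insert[OF finite_diagram diagram_remove_box(2)[OF assms]])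

lemma flagged_SSYT_lower_flag:
  assumes "\<And>m j. m \<in> flagged_SSYT l f \<Longrightarrow> (Suc i, j) \<in> diagram l \<Longrightarrow> m (Suc i, j) \<le> v"
    and "v \<le> f i"
  shows "flagged_SSYT l f = flagged_SSYT l (f(i := v))"
proof (intro equalityI subsetI)
  fix m assume m: "m \<in> flagged_SSYT l f"
  show "m \<in> flagged_SSYT l (f(i := v))"
  proof (rule flagged_SSYT_I)
    fix k j assume kj: "(k, j) \<in> diagram l"
    then have "k = Suc i \<or> k - 1 \<noteq> i" by (auto simp: diagram_def)
    then show "m (k, j) \<le> (f(i := v)) (k - 1)"
      using assms(1)[OF m] flagged_SSYT_D(2)[OF m kj] kj by auto
  qed (rule flagged_SSYT_D(1)[OF m])
next
  fix m assume m: "m \<in> flagged_SSYT l (f(i := v))"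
  have "(f(i := v)) k \<le> f k" for k using assms(2) by simp
  then show "m \<in> flagged_SSYT l f"
    using flagged_SSYT_D[OF m] by (blast intro: flagged_SSYT_I order_trans)
qed

text \<open>
  If the row below is equally long, then below every box of row \<open>i\<close> there is another one, whose entry is
  strictly larger and still subject to the same bound.
\<close>

lemma flagged_SSYT_same_row_below:
  assumes i: "Suc i < length l" "l ! i = l ! Suc i"
    and f: "f i = Suc v" "f (Suc i) = Suc v"
  shows "flagged_SSYT l f = flagged_SSYT l (f(i := v))"
proof -
  have "m (Suc i, j) \<le> v" if m: "m \<in> flagged_SSYT l f" and j: "(Suc i, j) \<in> diagram l" for m j
  proof -
    have j': "(Suc i + 1, j) \<in> diagram l"
      using i j by (auto simp: diagram_def)
    with j m have *: "m (Suc i, j) < m (Suc i + 1, j)"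
      using SSYT_D(4)[OF flagged_SSYT_D(1)] by blast
    have "m (Suc i + 1, j) \<le> Suc v"
      using flagged_SSYT_D(2)[OF m j'] f by simp
    with * show ?thesis by simp
  qed
  then show ?thesis by (rule flagged_SSYT_lower_flag) (use f in auto)
qed

lemma flagged_SSYT_empty_row:
  assumes "i < length l" "l ! i = 0"
  shows "flagged_SSYT l f = flagged_SSYT l (f(i := v))"
proof -
  have "i' - 1 \<noteq> i" if "(i', j) \<in> diagram l" for i' j
    using that assms by (auto simp: diagram_def)
  then have "(f(i := v)) (i' - 1) = f (i' - 1)" if "(i', j) \<in> diagram l" for i' j
    using that by auto
  then show ?thesis
    unfolding flagged_SSYT_def by (intro Collect_cong conj_cong ball_cong) auto
qed

text \<open>
  Putting the maximal entry \<open>v + 1\<close> into a new corner creates no conflict: its left neighbour is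
  bounded by \<open>f i = v + 1\<close>, and its upper neighbour by \<open>f (i - 1) \<le> v\<close>.
\<close>

lemma flagged_SSYT_top_corner_extend:
  assumes i: "i < length l" "0 < l ! i"
    and corner: "Suc i < length l \<Longrightarrow> l ! Suc i < l ! i"
    and f: "f i = Suc v" "i > 0 \<Longrightarrow> f (i - 1) \<le> v"
  defines "p \<equiv> (Suc i, l ! i)" and "l' \<equiv> l[i := l ! i - 1]"
  shows "bij_betw (\<lambda>m. m(p := Suc v)) (flagged_SSYT l' f) {m \<in> flagged_SSYT l f. m p = Suc v}"
proof (rule bij_betw_byWitness[where f' = "\<lambda>m. m(p := undefined)"])
  note D = diagram_remove_box[OF i, folded p_def l'_def]
  show "\<forall>m\<in>flagged_SSYT l' f. (m(p := Suc v))(p := undefined) = m"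
  proof
    fix m assume "m \<in> flagged_SSYT l' f"
    from SSYT_D(2)[OF flagged_SSYT_D(1)[OF this] D(2)] show "(m(p := Suc v))(p := undefined) = m" by (simp add: fun_upd_idem)
  qed
  show "\<forall>m\<in>{m \<in> flagged_SSYT l f. m p = Suc v}. (m(p := undefined))(p := Suc v) = m"
    by auto
  show "(\<lambda>m. m(p := undefined)) ` {m \<in> flagged_SSYT l f. m p = Suc v} \<subseteq> flagged_SSYT l' f"
  proof safe
    fix m assume m: "m \<in> flagged_SSYT l f" "m p = Suc v"
    have eq: "(m(p := undefined)) q = m q" if "q \<in> diagram l'" for q
      using that D by auto
    have sub: "q \<in> diagram l" if "q \<in> diagram l'" for q using that D by auto
    note S = SSYT_D[OF flagged_SSYT_D(1)[OF m(1)]]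
    show "m(p := undefined) \<in> flagged_SSYT l' f"
    proof (intro flagged_SSYT_I SSYT_I)
      show "(m(p := undefined)) q = undefined" if "q \<notin> diagram l'" for q
        using that S(2)[of q] D(1) by auto
    qed (simp_all only: eq sub S flagged_SSYT_D(2)[OF m(1)])
  qed
  show "(\<lambda>m. m(p := Suc v)) ` flagged_SSYT l' f \<subseteq> {m \<in> flagged_SSYT l f. m p = Suc v}"
  proof safe
    fix m assume m: "m \<in> flagged_SSYT l' f"
    let ?m = "m(p := Suc v)"
    note S = SSYT_D[OF flagged_SSYT_D(1)[OF m]] and fl = flagged_SSYT_D(2)[OF m]
    have fil: "q \<in> diagram l \<Longrightarrow> 1 \<le> ?m q" "q \<notin> diagram l \<Longrightarrow> ?m q = undefined" for q
      using S(1,2)[of q] D by auto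
    have row: "?m (k, j) \<le> ?m (k, j + 1)"
      if "(k, j) \<in> diagram l" "(k, j + 1) \<in> diagram l" for k j
    proof -
      have "(k, j) \<noteq> p" using that by (auto simp: p_def diagram_def)
      moreover from this have "(k, j) \<in> diagram l'" using that D by auto
      moreover have "m (k, j) \<le> Suc v" if "(k, j + 1) = p"
        using fl[of k j] \<open>(k, j) \<in> diagram l'\<close> that f by (auto simp: p_def)
      moreover have "m (k, j) \<le> m (k, j + 1)" if "(k, j + 1) \<noteq> p"
        using \<open>(k, j) \<in> diagram l'\<close> \<open>(k, j + 1) \<in> diagram l\<close> that D(1) S(3)[of k j] by blast
      ultimately show ?thesis by auto
    qed
    have col: "?m (k, j) < ?m (k + 1, j)"
      if "(k, j) \<in> diagram l" "(k + 1, j) \<in> diagram l" for k j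
    proof -
      have "(k, j) \<noteq> p" using that corner by (fastforce simp: p_def diagram_def)
      moreover from this have "(k, j) \<in> diagram l'" using that D by auto
      moreover have "m (k, j) < Suc v" if "(k + 1, j) = p"
      proof -
        have "k > 0" using \<open>(k, j) \<in> diagram l\<close> by (auto simp: diagram_def)
        then show ?thesis
        using fl[of k j] \<open>(k, j) \<in> diagram l'\<close> that f by (auto simp: p_def)
      qed
      moreover have "m (k, j) < m (k + 1, j)" if "(k + 1, j) \<noteq> p"
        using \<open>(k, j) \<in> diagram l'\<close> \<open>(k + 1, j) \<in> diagram l\<close> that D(1) S(4)[of k j] by blast
      ultimately show ?thesis by auto
    qed
    have "?m (k, j) \<le> f (k - 1)" if "(k, j) \<in> diagram l" for k j
      using fl[of k j] that D f by (cases "(k, j) = p") (auto simp: p_def)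
    with fil row col show "?m \<in> flagged_SSYT l f"
      by (intro flagged_SSYT_I SSYT_I)
  qed simp
qed

text \<open>
  Rows increase weakly, so the last box decides whether a whole row stays below the bound.
\<close>

lemma flagged_SSYT_corner_not_top:
  assumes i: "i < length l" "0 < l ! i" and f: "f i = Suc v"
  shows "{m \<in> flagged_SSYT l f. m (Suc i, l ! i) \<noteq> Suc v} = flagged_SSYT l (f(i := v))"
proof (intro equalityI subsetI)
  have p: "(Suc i, l ! i) \<in> diagram l" using i by (auto simp: diagram_def)
  fix m assume "m \<in> {m \<in> flagged_SSYT l f. m (Suc i, l ! i) \<noteq> Suc v}"
  then have m: "m \<in> flagged_SSYT l f" and ne: "m (Suc i, l ! i) \<noteq> Suc v" by auto
  have "m (Suc i, l ! i) \<le> Suc v" using flagged_SSYT_D(2)[OF m p] f by simp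
  with ne have le: "m (Suc i, l ! i) \<le> v" by simp
  have row: "m (Suc i, j) \<le> v" if "(Suc i, j) \<in> diagram l" for j
    using SSYT_row_mono[OF flagged_SSYT_D(1)[OF m] p, of j] that le
    by (auto simp: diagram_def)
  show "m \<in> flagged_SSYT l (f(i := v))"
  proof (rule flagged_SSYT_I)
    fix k j assume kj: "(k, j) \<in> diagram l"
    then have "k = Suc i \<or> k - 1 \<noteq> i" by (auto simp: diagram_def)
    then show "m (k, j) \<le> (f(i := v)) (k - 1)"
      using row flagged_SSYT_D(2)[OF m kj] kj by auto
  qed (rule flagged_SSYT_D(1)[OF m])
next
  fix m assume m: "m \<in> flagged_SSYT l (f(i := v))"
  have "(Suc i, l ! i) \<in> diagram l" using i by (auto simp: diagram_def)
  then have "m (Suc i, l ! i) \<le> (f(i := v)) (Suc i - 1)"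
    by (rule flagged_SSYT_D(2)[OF m])
  then have "m (Suc i, l ! i) \<le> v" by simp
  moreover have "(f(i := v)) k \<le> f k" for k using f by simp
  then have "m \<in> flagged_SSYT l f"
    using flagged_SSYT_D[OF m] by (blast intro: flagged_SSYT_I order_trans)
  ultimately show "m \<in> {m \<in> flagged_SSYT l f. m (Suc i, l ! i) \<noteq> Suc v}" by auto
qed

lemma flagged_schur_corner:
  assumes i: "i < length l" "0 < l ! i"
    and corner: "Suc i < length l \<Longrightarrow> l ! Suc i < l ! i"
    and f: "f i = Suc v" "i > 0 \<Longrightarrow> f (i - 1) \<le> v"
  shows "flagged_schur x l f = flagged_schur x l (f(i := v))
     + x (int (l ! i) - int i - 1) (Suc v) * flagged_schur x (l[i := l ! i - 1]) f"
proof -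
  define p where "p = (Suc i, l ! i)"
  define l' where "l' = l[i := l ! i - 1]"
  note D = diagram_remove_box[OF i, folded p_def l'_def]
  let ?w = "\<lambda>l m. \<Prod>(i, j)\<in>diagram l. x (int j - int i) (m (i, j))"
  have "flagged_schur x l f = (\<Sum>m\<in>{m \<in> flagged_SSYT l f. m p \<noteq> Suc v}. ?w l m)
      + (\<Sum>m\<in>{m \<in> flagged_SSYT l f. m p = Suc v}. ?w l m)"
    unfolding flagged_schur_def
    by (subst sum.union_disjoint[symmetric]) (auto simp: finite_flagged_SSYT intro!: sum.cong)
  also have "(\<Sum>m\<in>{m \<in> flagged_SSYT l f. m p \<noteq> Suc v}. ?w l m) = flagged_schur x l (f(i := v))"
    using flagged_SSYT_corner_not_top[of i l f v] i f by (simp add: p_def flagged_schur_def)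
  also have "(\<Sum>m\<in>{m \<in> flagged_SSYT l f. m p = Suc v}. ?w l m)
      = (\<Sum>m\<in>flagged_SSYT l' f. ?w l (m(p := Suc v)))"
    using sum.reindex_bij_betw[OF flagged_SSYT_top_corner_extend[OF assms], of "?w l"]
    by (simp add: p_def l'_def)
  also have "\<dots> = (\<Sum>m\<in>flagged_SSYT l' f. x (int (l ! i) - int i - 1) (Suc v) * ?w l' m)"
  proof (rule sum.cong[OF refl])
    fix m assume "m \<in> flagged_SSYT l' f"
    have "?w l (m(p := Suc v)) = x (int (l ! i) - int i - 1) (Suc v) * ?w l' (m(p := Suc v))"
      unfolding prod_diagram_remove_box[OF i] by (simp add: p_def l'_def algebra_simps)
    also have "?w l' (m(p := Suc v)) = ?w l' m"
      using D(2) by (intro prod.cong) auto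
    finally show "?w l (m(p := Suc v)) = x (int (l ! i) - int i - 1) (Suc v) * ?w l' m" .
  qed
  finally show ?thesis
    unfolding flagged_schur_def l'_def[symmetric] sum_distrib_left .
qed

section \<open>The Jacobi-Trudi formula for flagged tableaux\<close>

lemma det_linear_in_row:
  fixes g h k :: "nat \<Rightarrow> nat \<Rightarrow> 'a::comm_ring_1"
  assumes i: "i < n"
    and row: "\<And>j. j < n \<Longrightarrow> g i j = h i j + c * k i j"
    and other: "\<And>i' j. i' \<noteq> i \<Longrightarrow> g i' j = h i' j" "\<And>i' j. i' \<noteq> i \<Longrightarrow> g i' j = k i' j"
  shows "Determinant.det (mat n n (\<lambda>(i, j). g i j)) =
    Determinant.det (mat n n (\<lambda>(i, j). h i j)) + c * Determinant.det (mat n n (\<lambda>(i, j). k i j))"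
proof -
  have split: "(\<Prod>i'=0..<n. g i' (p i')) =
      (\<Prod>i'=0..<n. h i' (p i')) + c * (\<Prod>i'=0..<n. k i' (p i'))"
    if p: "p permutes {0..<n}" for p
  proof -
    have "p i < n" using permutes_in_image[OF p, of i] i by simp
    moreover have "(\<Prod>i'\<in>{0..<n} - {i}. h i' (p i')) = (\<Prod>i'\<in>{0..<n} - {i}. g i' (p i'))"
      "(\<Prod>i'\<in>{0..<n} - {i}. k i' (p i')) = (\<Prod>i'\<in>{0..<n} - {i}. g i' (p i'))"
      using other by (auto intro!: prod.cong)
    ultimately show ?thesis
      using i row by (simp add: prod.remove[of "{0..<n}" i] algebra_simps)
  qed
  have ent: "(\<Prod>i'=0..<n. mat n n (\<lambda>(i, j). q i j) $$ (i', p i')) = (\<Prod>i'=0..<n. q i' (p i'))"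
    if p: "p permutes {0..<n}" for p and q :: "nat \<Rightarrow> nat \<Rightarrow> 'a"
    using permutes_in_image[OF p] by (intro prod.cong) auto
  show ?thesis
    by (simp add: det_def'[OF mat_carrier] ent split sum_distrib_left algebra_simps flip: sum.distrib)
qed

lemma sorted_wrt_ge_nth: "sorted_wrt (\<ge>) (l :: nat list) \<Longrightarrow> i \<le> j \<Longrightarrow> j < length l \<Longrightarrow> l ! j \<le> l ! i"
  by (cases "i = j") (auto simp: sorted_wrt_iff_nth_less)

lemma sorted_wrt_ge_remove_box:
  assumes l: "sorted_wrt (\<ge>) (l :: nat list)" and i: "i < length l"
    and corner: "Suc i < length l \<Longrightarrow> l ! Suc i < l ! i"
  shows "sorted_wrt (\<ge>) (l[i := l ! i - 1])"
  unfolding sorted_wrt_iff_nth_less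
proof (intro allI impI)
  fix j k assume jk: "j < k" "k < length (l[i := l ! i - 1])"
  have "l ! k \<le> l ! i - 1" if "j = i"
    using sorted_wrt_ge_nth[OF l, of "Suc i" k] jk that corner by auto
  then show "l[i := l ! i - 1] ! j \<ge> l[i := l ! i - 1] ! k"
    using sorted_wrt_ge_nth[OF l, of j k] jk
    by (cases "j = i"; cases "k = i") (auto simp: nth_list_update)
qed

text \<open>
  The induction is on the sum of all row bounds and all parts.  Individual row bounds are what makes
  it work: lowering a common bound for all rows at once would remove a whole horizontal strip, while
  here a single box is removed and the determinant changes in a single row.
\<close>

theorem flagged_jacobi_trudi:
  assumes "sorted_wrt (\<ge>) l" and "mono f"
  shows "flagged_schur x l f = Determinant.det (mat (length l) (length l)
    (\<lambda>(i, j). star_sum x (f i) (- int j) (int (l ! i) - int i)))"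
  using assms
proof (induction "sum f {..<length l} + sum_list l" arbitrary: f l rule: less_induct)
  case less
  define r where "r = length l"
  let ?J = "\<lambda>l f. Determinant.det (mat r r
    (\<lambda>(i, j). star_sum x (f i) (- int j) (int (l ! i) - int i)))"
  consider "\<forall>i<r. f i = 0" "\<forall>i<r. l ! i = 0" | "\<forall>i<r. f i = 0" "\<exists>i<r. l ! i > 0" 
    | "r > 0" "f (r - 1) > 0"
  proof (cases "\<forall>i<r. f i = 0")
    case False
    then obtain i where "i < r" "f i > 0" by auto
    moreover from this have "i \<le> r - 1" by simp
    ultimately have "r > 0" "f (r - 1) > 0" using monoD[OF less.prems(2), of i "r - 1"] by auto
    then show ?thesis using that by blast
  next
    case True
    then show ?thesis using that by (cases "\<forall>i<r. l ! i = 0") auto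
  qed
  then have "flagged_schur x l f = ?J l f"
  proof cases
    case 1
    then have d: "diagram l = {}" by (auto simp: diagram_def r_def)
    then have "flagged_SSYT l f = {\<lambda>_. undefined}"
      by (auto simp: flagged_SSYT_def SSYT_def fillings_def)
    from d this have "flagged_schur x l f = 1" by (simp add: flagged_schur_def d)
    moreover have "mat r r (\<lambda>(i, j). star_sum x (f i) (- int j) (int (l ! i) - int i)) = 1\<^sub>m r"
      using 1 by (intro eq_matI) (auto simp: star_sum_bound_0)
    ultimately show ?thesis by simp
  next
    case 2
    then have "0 < r" "l ! 0 > 0"
      using sorted_wrt_ge_nth[OF less.prems(1), of 0] by (fastforce simp: r_def)+
    then have p: "(1, 1) \<in> diagram l" by (auto simp: diagram_def r_def Suc_le_eq)
    have "flagged_SSYT l f = {}"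
    proof (rule equals0I)
      fix m assume m: "m \<in> flagged_SSYT l f"
      then have "m (1, 1) \<le> f 0" "m (1, 1) \<ge> 1"
        using flagged_SSYT_D(2)[OF m p] SSYT_D(1)[OF flagged_SSYT_D(1)[OF m] p] by auto
      then show False using 2 \<open>0 < r\<close> by auto
    qed
    then have "flagged_schur x l f = 0" by (simp add: flagged_schur_def)
    moreover have "?J l f = 0"
    proof -
      have "mat r r (\<lambda>(i, j). star_sum x (f i) (- int j) (int (l ! i) - int i))
         = mat\<^sub>r r r (\<lambda>i. if i = 0 then 0\<^sub>v r else row (mat r r (\<lambda>(i, j). star_sum x (f i) (- int j) (int (l ! i) - int i))) i)"
        using \<open>0 < r\<close> \<open>l ! 0 > 0\<close> 2 by (intro eq_matI) (auto simp: star_sum_bound_0)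
      then show ?thesis using det_row_0[OF \<open>0 < r\<close>, of "\<lambda>i. row (mat r r (\<lambda>(i, j). star_sum x (f i) (- int j) (int (l ! i) - int i))) i"]
        by auto
    qed
    ultimately show ?thesis by simp
  next
    case 3
    \<comment> \<open>The topmost row with the largest bound: the row above has a smaller bound, so lowering the bound of this row keeps \<open>f\<close> monotone, and a row below has the same bound.\<close>
    define i where "i = (LEAST i. f i = f (r - 1))"
    have fi: "f i = f (r - 1)" unfolding i_def by (rule LeastI) simp
    have i_le: "i \<le> r - 1" unfolding i_def by (rule Least_le) simp
    then have i: "i < r" using 3 by simp
    obtain v where v: "f i = Suc v" using fi 3 gr0_implies_Suc by metis
    have below: "f k \<le> v" if "k < i" for k
      using not_less_Least[OF that[unfolded i_def]] monoD[OF less.prems(2), of k i] that fi v by auto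
    have above: "f (Suc i) = Suc v" if "Suc i < r"
      using monoD[OF less.prems(2), of i "Suc i"] monoD[OF less.prems(2), of "Suc i" "r - 1"] that fi v
      by auto
    let ?f = "f(i := v)"
    have mono': "mono ?f"
    proof (rule monoI)
      fix a b :: nat assume ab: "a \<le> b"
      show "?f a \<le> ?f b"
        using monoD[OF less.prems(2) ab] below[of a] v ab by (cases "a = i"; cases "b = i") auto
    qed
    have "sum ?f {..<r} < sum f {..<r}"
      using i v by (intro sum_strict_mono_ex1) auto
    then have IH1: "flagged_schur x l ?f = ?J l ?f"
      using less.hyps[of ?f l] less.prems mono' by (simp add: r_def)
    let ?c = "x (int (l ! i) - int i - 1) (Suc v)"
    \<comment> \<open>The correction matrix: row \<open>i\<close> has the shape of a row with one box less.\<close>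
    let ?k = "\<lambda>i' j. if i' = i then star_sum x (Suc v) (- int j) (int (l ! i) - int i - 1)
                 else star_sum x (f i') (- int j) (int (l ! i') - int i')"
    have J: "?J l f = ?J l ?f + ?c * Determinant.det (mat r r (\<lambda>(i, j). ?k i j))"
    proof (rule det_linear_in_row[OF i])
      show "star_sum x (f i) (- int j) (int (l ! i) - int i)
          = star_sum x (?f i) (- int j) (int (l ! i) - int i) + ?c * ?k i j" for j
        using star_sum_Suc[of x v "- int j" "int (l ! i) - int i"] v by simp
    qed auto
    consider "Suc i < r" "l ! i = l ! Suc i" | "Suc i = r" "l ! i = 0"
      | "0 < l ! i" "Suc i < r \<Longrightarrow> l ! Suc i < l ! i"
      using sorted_wrt_ge_nth[OF less.prems(1), of i "Suc i"] i by (fastforce simp: r_def)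
    then show ?thesis
    \<comment> \<open>In the first case the correction matrix has two equal rows, in the second one a zero row; in both, no tableau attains the bound in row \<open>i\<close>. In the third case the last box of the row is a corner.\<close>
    proof cases
      case 1
      have "Determinant.det (mat r r (\<lambda>(i, j). ?k i j)) = 0"
        by (rule det_identical_rows[of _ r i "Suc i"])
           (use 1 i above in \<open>auto intro!: eq_vecI simp: algebra_simps\<close>)
      moreover have "flagged_SSYT l f = flagged_SSYT l ?f"
        by (rule flagged_SSYT_same_row_below) (use 1 v above in \<open>auto simp: r_def\<close>)
      then have "flagged_schur x l f = flagged_schur x l ?f"
        unfolding flagged_schur_def by (rule sum.cong) (rule refl)
      ultimately show ?thesis using J IH1 by simp
    next
      case 2
      have "mat r r (\<lambda>(i, j). ?k i j) = mat\<^sub>r r r (\<lambda>i'. if i' = i then 0\<^sub>v r else row (mat r r (\<lambda>(i, j). ?k i j)) i')"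
        using 2 by (intro eq_matI) (auto simp: star_sum_less)
      then have "Determinant.det (mat r r (\<lambda>(i, j). ?k i j)) = 0"
        using det_row_0[OF i, of "\<lambda>i'. row (mat r r (\<lambda>(i, j). ?k i j)) i'"] by auto
      moreover have "flagged_SSYT l f = flagged_SSYT l ?f"
        by (rule flagged_SSYT_empty_row) (use 2 i in \<open>auto simp: r_def\<close>)
      then have "flagged_schur x l f = flagged_schur x l ?f"
        unfolding flagged_schur_def by (rule sum.cong) (rule refl)
      ultimately show ?thesis using J IH1 by simp
    next
      case 3
      let ?l = "l[i := l ! i - 1]"
      have "sum_list ?l < sum_list l"
        using 3 i sum_list_update[of i l "l ! i - 1"] elem_le_sum_list[of i l] by (auto simp: r_def)
      then have IH2: "flagged_schur x ?l f = ?J ?l f"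
        using less.hyps[of f ?l] less.prems sorted_wrt_ge_remove_box[OF less.prems(1), of i] 3 i
        by (simp add: r_def)
      have "mat r r (\<lambda>(i', j). star_sum x (f i') (- int j) (int (?l ! i') - int i'))
          = mat r r (\<lambda>(i, j). ?k i j)"
        using 3 i v by (intro eq_matI) (auto simp: r_def nth_list_update of_nat_diff algebra_simps)
      with IH2 have "flagged_schur x ?l f = Determinant.det (mat r r (\<lambda>(i, j). ?k i j))" by simp
      moreover have "flagged_schur x l f = flagged_schur x l ?f + ?c * flagged_schur x ?l f"
        by (rule flagged_schur_corner) (use 3 i v below in \<open>auto simp: r_def\<close>)
      ultimately show ?thesis using J IH1 by simp
    qed
  qed
  then show ?case by (simp add: r_def)
qed

section \<open>Column sets and partitions\<close>

text \<open>
  The beta numbers of a partition (its first-column hook lengths if no part is zero), in increasing order: with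
  \<open>r\<close> parts, the index \<open>k\<close> corresponds to the part with index \<open>r - 1 - k\<close>.
\<close>

definition beta_num :: "nat list \<Rightarrow> nat \<Rightarrow> nat" where
  "beta_num l k = l ! (length l - 1 - k) + k"

text \<open>
  The permutation that lists first the columns belonging to the partition and then the remaining ones,
  both in increasing order.
\<close>

definition shuffle_perm :: "nat \<Rightarrow> nat \<Rightarrow> nat list \<Rightarrow> nat \<Rightarrow> nat" where
  "shuffle_perm s r l k =
     (if k < r then beta_num l k
      else if k < r + s then beta_num (dual_partition s r l) (k - r)
      else k)"

lemma partitions_in_rect_D:
  assumes "l \<in> partitions_in_rect s r"
  shows "length l = r" and "i \<le> j \<Longrightarrow> j < r \<Longrightarrow> l ! j \<le> l ! i" and "i < r \<Longrightarrow> l ! i \<le> s"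
proof -
  show "i \<le> j \<Longrightarrow> j < r \<Longrightarrow> l ! j \<le> l ! i"
    using assms by (cases "i = j") (auto simp: partitions_in_rect_def sorted_wrt_iff_nth_less)
qed (use assms in \<open>auto simp: partitions_in_rect_def\<close>)

lemma partitions_in_rect_I:
  assumes "length l = r" and "\<And>i j. i < j \<Longrightarrow> j < r \<Longrightarrow> l ! j \<le> l ! i"
    and "\<And>i. i < r \<Longrightarrow> l ! i \<le> s"
  shows "l \<in> partitions_in_rect s r"
  using assms by (auto simp: partitions_in_rect_def sorted_wrt_iff_nth_less in_set_conv_nth)

text \<open>
  The parts of size at least \<open>j\<close> form an initial segment, of which \<open>conj_part l j\<close> is the length.
\<close>

lemma less_conj_part_iff:
  assumes l: "l \<in> partitions_in_rect s r" and i: "i < r"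
  shows "i < conj_part l j \<longleftrightarrow> j \<le> l ! i"
proof
  note D = partitions_in_rect_D[OF l]
  show "i < conj_part l j" if "j \<le> l ! i"
  proof -
    have "{..i} \<subseteq> {k. k < length l \<and> j \<le> l ! k}"
      using that i D(1) by (auto intro: order_trans[OF _ D(2)])
    then have "card {..i} \<le> conj_part l j" unfolding conj_part_def by (intro card_mono) auto
    then show ?thesis by simp
  qed
  show "j \<le> l ! i" if "i < conj_part l j"
  proof (rule ccontr)
    assume "\<not> j \<le> l ! i"
    then have "k < i" if "k < r" "j \<le> l ! k" for k
      using that D(2)[of i k] by (cases "k < i") auto
    then have "{k. k < length l \<and> j \<le> l ! k} \<subseteq> {..<i}" using D(1) by auto
    then have "conj_part l j \<le> card {..<i}" unfolding conj_part_def by (intro card_mono) auto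
    then show False using that by simp
  qed
qed

lemma conj_part_le: "conj_part l j \<le> length l"
  unfolding conj_part_def by (rule order_trans[OF card_mono[of "{..<length l}"]]) auto

lemma conj_part_antimono: "i \<le> j \<Longrightarrow> conj_part l j \<le> conj_part l i"
  unfolding conj_part_def by (intro card_mono) auto

lemma dual_partition_nth: "j < s \<Longrightarrow> dual_partition s r l ! (s - 1 - j) = r - conj_part l (Suc j)"
  by (simp add: dual_partition_def rev_nth Suc_diff_Suc plus_1_eq_Suc del: upt_Suc One_nat_def)

lemma length_dual_partition [simp]: "length (dual_partition s r l) = s"
  by (simp add: dual_partition_def del: upt_Suc)

lemma dual_partition_in_rect: "dual_partition s r l \<in> partitions_in_rect r s"
proof (rule partitions_in_rect_I)
  have nth: "dual_partition s r l ! i = r - conj_part l (s - i)" if "i < s" for i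
    using dual_partition_nth[of "s - 1 - i" s] that by (simp add: Suc_diff_Suc)
  show "dual_partition s r l ! j \<le> dual_partition s r l ! i" if "i < j" "j < s" for i j
    using that conj_part_antimono[of "s - j" "s - i" l] by (simp add: nth diff_le_mono2)
  show "dual_partition s r l ! i \<le> r" if "i < s" for i
    using that by (simp add: nth)
qed simp

lemma beta_num_dual_partition:
  "j < s \<Longrightarrow> beta_num (dual_partition s r l) j = r - conj_part l (Suc j) + j"
  unfolding beta_num_def length_dual_partition by (simp only: dual_partition_nth)

lemma beta_num_strict_mono:
  assumes "l \<in> partitions_in_rect s r" "j < k" "k < r"
  shows "beta_num l j < beta_num l k"
  using partitions_in_rect_D(1)[OF assms(1)] assms(2,3)
    partitions_in_rect_D(2)[OF assms(1), of "r - 1 - k" "r - 1 - j"]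
    diff_le_mono2[of "Suc j" "Suc k" r]
  by (simp add: beta_num_def)

lemma beta_num_less: "l \<in> partitions_in_rect s r \<Longrightarrow> k < r \<Longrightarrow> beta_num l k < r + s"
  using partitions_in_rect_D(1)[of l s r] partitions_in_rect_D(3)[of l s r "r - 1 - k"] by (simp add: beta_num_def)

text \<open>
  Write \<open>i = r - 1 - k\<close>.  If the box in row \<open>i\<close> and column \<open>j\<close> (both counted from 0) belongs to the
  diagram, the beta number is larger than the dual one, otherwise it is smaller.
\<close>

lemma beta_num_neq_dual:
  assumes l: "l \<in> partitions_in_rect s r" and k: "k < r" and j: "j < s"
  shows "beta_num l k \<noteq> beta_num (dual_partition s r l) j"
proof -
  define i where "i = r - 1 - k"
  have i: "i < r" "k = r - 1 - i" using k by (auto simp: i_def)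
  note D = partitions_in_rect_D(1)[OF l]
  show ?thesis
    using less_conj_part_iff[OF l i(1), of "Suc j"] i conj_part_le[of l "Suc j"] j
    unfolding beta_num_dual_partition[OF j] by (simp add: beta_num_def D) linarith
qed

lemma shuffle_perm_permutes:
  assumes l: "l \<in> partitions_in_rect s r"
  shows "shuffle_perm s r l permutes {0..<r + s}"
proof (rule bij_imp_permutes)
  note d = dual_partition_in_rect[of s r l]
  have inj: "inj_on (shuffle_perm s r l) {0..<r + s}"
  proof (rule linorder_inj_onI)
    fix j k assume jk: "j < k" "j \<in> {0..<r + s}" "k \<in> {0..<r + s}"
    then have "j - r < k - r" "k - r < s" if "\<not> j < r" using that by auto
    with jk show "shuffle_perm s r l j \<noteq> shuffle_perm s r l k"
      using beta_num_strict_mono[OF l, of j k] beta_num_strict_mono[OF d, of "j - r" "k - r"]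
        beta_num_neq_dual[OF l, of j "k - r"]
      by (cases "j < r"; cases "k < r") (auto simp: shuffle_perm_def)
  qed auto
  have "shuffle_perm s r l ` {0..<r + s} \<subseteq> {0..<r + s}"
    using beta_num_less[OF l] beta_num_less[OF d] by (auto simp: shuffle_perm_def add.commute)
  with inj show "bij_betw (shuffle_perm s r l) {0..<r + s} {0..<r + s}"
    by (simp add: bij_betw_def endo_inj_surj)
qed (simp add: shuffle_perm_def)

text \<open>
  A box added in row \<open>i\<close> raises the corresponding beta number from \<open>v\<close> to \<open>v + 1\<close>; as both shuffles are
  permutations, the complementary column \<open>v + 1\<close> has to move to \<open>v\<close>.
\<close>

lemma shuffle_perm_add_box:
  assumes l: "l \<in> partitions_in_rect s r" and i: "i < r" "l ! i > 0"
    and corner: "Suc i < r \<Longrightarrow> l ! Suc i < l ! i"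
  defines "l' \<equiv> l[i := l ! i - 1]" and "v \<equiv> l ! i - 1 + (r - 1 - i)"
  shows "l' \<in> partitions_in_rect s r"
    and "shuffle_perm s r l = Transposition.transpose v (Suc v) \<circ> shuffle_perm s r l'"
proof -
  note D = partitions_in_rect_D[OF l]
  show l': "l' \<in> partitions_in_rect s r"
  proof (rule partitions_in_rect_I)
    show "l' ! k \<le> l' ! j" if "j < k" "k < r" for j k
      using that D(2)[of j k] D(2)[of "Suc i" k] corner D(1)
      by (cases "j = i"; cases "k = i") (auto simp: l'_def)
    show "l' ! k \<le> s" if "k < r" for k
      using that D(3)[of k] D(1) by (cases "k = i") (auto simp: l'_def)
  qed (simp add: l'_def D)
  let ?k0 = "r - 1 - i" and ?k1 = "r + (l ! i - 1)"
  have lis: "l ! i \<le> s" using D(3) i by simp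
  have k0: "shuffle_perm s r l ?k0 = Suc v" "shuffle_perm s r l' ?k0 = v"
    using i by (auto simp: shuffle_perm_def beta_num_def D v_def l'_def)
  have "conj_part l (l ! i) = Suc i"
  proof -
    have "i < conj_part l (l ! i)" using less_conj_part_iff[OF l i(1)] by simp
    moreover have "\<not> Suc i < conj_part l (l ! i)"
      using less_conj_part_iff[OF l, of "Suc i" "l ! i"] corner conj_part_le[of l "l ! i"] D(1)
      by (cases "Suc i < r") auto
    ultimately show ?thesis by simp
  qed
  moreover have "conj_part l' (l ! i) = i"
  proof -
    have "\<not> i < conj_part l' (l ! i)"
      using less_conj_part_iff[OF l' i(1), of "l ! i"] i D(1) by (simp add: l'_def)
    moreover have "i - 1 < conj_part l' (l ! i)" if "i > 0"
      using less_conj_part_iff[OF l', of "i - 1" "l ! i"] i D that by (simp add: l'_def)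
    ultimately show ?thesis by (cases i) auto
  qed
  ultimately have k1: "shuffle_perm s r l ?k1 = v" "shuffle_perm s r l' ?k1 = Suc v"
    using i lis by (auto simp: shuffle_perm_def beta_num_dual_partition v_def Suc_diff_Suc)
  have other: "shuffle_perm s r l k = shuffle_perm s r l' k" if k: "k \<noteq> ?k0" "k \<noteq> ?k1" for k
  proof -
    consider "k < r" | "r \<le> k" "k < r + s" | "r + s \<le> k" by linarith
    then show ?thesis
    proof cases
      case 1
      then show ?thesis using k D(1) i by (simp add: shuffle_perm_def beta_num_def l'_def)
    next
      case 2
      then have "Suc (k - r) \<noteq> l ! i" using k i by auto
      then have "{j. j < length l \<and> Suc (k - r) \<le> l ! j} = {j. j < length l' \<and> Suc (k - r) \<le> l' ! j}"
        using D(1) i by (auto simp: l'_def nth_list_update split: if_splits)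
      then have "conj_part l (Suc (k - r)) = conj_part l' (Suc (k - r))"
        by (simp add: conj_part_def)
      with 2 show ?thesis by (simp add: shuffle_perm_def beta_num_dual_partition)
    qed (simp add: shuffle_perm_def)
  qed
  show "shuffle_perm s r l = Transposition.transpose v (Suc v) \<circ> shuffle_perm s r l'"
  proof
    fix k
    consider "k = ?k0" | "k = ?k1" | "k \<noteq> ?k0" "k \<noteq> ?k1" by blast
    then show "shuffle_perm s r l k = (Transposition.transpose v (Suc v) \<circ> shuffle_perm s r l') k"
    proof cases
      case 3
      then have "shuffle_perm s r l k \<noteq> Suc v" "shuffle_perm s r l' k \<noteq> v"
        using permutes_inj[OF shuffle_perm_permutes[OF l]] permutes_inj[OF shuffle_perm_permutes[OF l']] k0
        by (metis injD)+
      with 3 show ?thesis by (simp add: other transpose_apply_other)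
    qed (simp_all only: k0 k1 o_apply transpose_apply_first transpose_apply_second)
  qed
qed

lemma sign_shuffle_perm:
  assumes "l \<in> partitions_in_rect s r"
  shows "sign (shuffle_perm s r l) = (-1) ^ sum_list l"
  using assms
proof (induction "sum_list l" arbitrary: l rule: less_induct)
  case less
  note D = partitions_in_rect_D[OF less.prems]
  show ?case
  proof (cases "\<forall>i<r. l ! i = 0")
    case True
    then have "conj_part l (Suc j) = 0" for j using D(1) by (simp add: conj_part_def)
    with True have "shuffle_perm s r l k = id k" for k
      using D(1) by (simp add: shuffle_perm_def beta_num_dual_partition)
         (simp add: beta_num_def)
    then have "shuffle_perm s r l = id" by blast
    moreover have "sum_list l = 0"
      using True D(1) by (auto simp: sum_list_eq_0_iff in_set_conv_nth)
    ultimately show ?thesis by (simp only: sign_id power_0)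
  next
    case False
    \<comment> \<open>The last box of the last nonempty row is a corner.\<close>
    define i where "i = Max {i. i < r \<and> 0 < l ! i}"
    have "i \<in> {i. i < r \<and> 0 < l ! i}" unfolding i_def by (rule Max_in) (use False in auto)
    then have i: "i < r" "0 < l ! i" by auto
    have "l ! Suc i = 0" if "Suc i < r"
    proof (rule ccontr)
      assume "l ! Suc i \<noteq> 0"
      then have "Suc i \<le> i" unfolding i_def[symmetric] using that
        by (subst (2) i_def) (intro Max_ge, auto)
      then show False by simp
    qed
    with i have corner: "Suc i < r \<Longrightarrow> l ! Suc i < l ! i" by simp
    note step = shuffle_perm_add_box[OF less.prems i corner]
    have sum: "sum_list l = Suc (sum_list (l[i := l ! i - 1]))"
      using i sum_list_update[of i l "l ! i - 1"] elem_le_sum_list[of i l] D(1) by auto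
    have "sign (shuffle_perm s r l) = - sign (shuffle_perm s r (l[i := l ! i - 1]))"
      using permutes_imp_permutation[OF _ shuffle_perm_permutes[OF step(1)]]
      by (subst step(2)) (simp_all add: sign_compose sign_swap_id permutation_swap_id)
    with less.hyps[OF _ step(1)] sum show ?thesis by simp
  qed
qed

lemma strict_sorted_nth_add:
  assumes "sorted_wrt (<) (xs :: nat list)" "j \<le> k" "k < length xs"
  shows "xs ! j + (k - j) \<le> xs ! k"
  using assms(2,3)
proof (induction k rule: dec_induct)
  case (step n)
  then show ?case using sorted_wrt_nth_less[OF assms(1), of n "Suc n"] by simp
qed simp

text \<open>
  A set is determined by its increasing enumeration \<open>xs\<close>, and subtracting \<open>k\<close> from \<open>xs ! k\<close> turns strictly
  increasing sequences into weakly increasing ones.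
\<close>

lemma bij_betw_partitions_subsets:
  "bij_betw (\<lambda>l. beta_num l ` {..<r}) (partitions_in_rect s r)
     {S. S \<subseteq> {..<r + s} \<and> card S = r}"
proof (rule bij_betw_imageI)
  show "inj_on (\<lambda>l. beta_num l ` {..<r}) (partitions_in_rect s r)"
  proof (rule inj_onI)
    fix l l' assume l: "l \<in> partitions_in_rect s r" and l': "l' \<in> partitions_in_rect s r"
      and eq: "beta_num l ` {..<r} = beta_num l' ` {..<r}"
    have sorted: "sorted_wrt (<) (map (beta_num l) [0..<r])" if "l \<in> partitions_in_rect s r" for l
      using beta_num_strict_mono[OF that] by (simp add: sorted_wrt_iff_nth_less)
    have "map (beta_num l) [0..<r] = map (beta_num l') [0..<r]"
      by (rule strict_sorted_equal)
         (use sorted[OF l] sorted[OF l'] eq in \<open>auto simp: atLeast0LessThan\<close>)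
    then have "beta_num l (r - 1 - i) = beta_num l' (r - 1 - i)" if "i < r" for i
      using that by auto
    moreover have "beta_num k (r - 1 - i) = k ! i + (r - 1 - i)"
      if "k \<in> partitions_in_rect s r" "i < r" for k i
      using partitions_in_rect_D(1)[OF that(1)] that(2) by (simp add: beta_num_def)
    ultimately have "l ! i = l' ! i" if "i < r" for i using l l' that by fastforce
    then show "l = l'"
      using partitions_in_rect_D(1)[OF l] partitions_in_rect_D(1)[OF l']
      by (intro nth_equalityI) auto
  qed
  show "(\<lambda>l. beta_num l ` {..<r}) ` partitions_in_rect s r = {S. S \<subseteq> {..<r + s} \<and> card S = r}"
  proof (intro equalityI image_subsetI subsetI)
    fix l assume l: "l \<in> partitions_in_rect s r"
    have "inj_on (beta_num l) {..<r}"
      using beta_num_strict_mono[OF l] by (intro linorder_inj_onI) (auto simp: less_le)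
    then show "beta_num l ` {..<r} \<in> {S. S \<subseteq> {..<r + s} \<and> card S = r}"
      using beta_num_less[OF l] by (auto simp: card_image)
  next
    fix S assume "S \<in> {S. S \<subseteq> {..<r + s} \<and> card S = r}"
    then have S: "S \<subseteq> {..<r + s}" and r: "card S = r" by auto
    define xs where "xs = sorted_list_of_set S"
    have fin: "finite S" using S finite_subset by blast
    have xs: "length xs = r" "set xs = S" "sorted_wrt (<) xs"
      using fin by (auto simp: xs_def r)
    note add = strict_sorted_nth_add[OF xs(3), unfolded xs(1)]
    have ge: "k \<le> xs ! k" if "k < r" for k using add[of 0 k] that by simp
    define l where "l = map (\<lambda>i. xs ! (r - 1 - i) - (r - 1 - i)) [0..<r]"
    have nth: "l ! i = xs ! (r - 1 - i) - (r - 1 - i)" if "i < r" for i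
      using that by (simp add: l_def)
    have "l \<in> partitions_in_rect s r"
    proof (rule partitions_in_rect_I)
      show "l ! j \<le> l ! i" if "i < j" "j < r" for i j
      proof -
        have diff_mono: "x - p \<le> y - q" if "x + d \<le> y" "q = p + d" for x y p q d :: nat
          using that by linarith
        have e: "r - 1 - i = (r - 1 - j) + (j - i)" using that by simp
        then have le: "xs ! (r - 1 - j) + (j - i) \<le> xs ! (r - 1 - i)"
          using add[of "r - 1 - j" "r - 1 - i"] that by simp
        have "i < r" using that by simp
        show ?thesis
          unfolding nth[OF \<open>j < r\<close>] nth[OF \<open>i < r\<close>] by (rule diff_mono[OF le e])
      qed
      show "l ! i \<le> s" if "i < r" for i
      proof -
        have "xs ! (r - 1) < r + s" using xs S that nth_mem[of "r - 1" xs] by auto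
        then show ?thesis
          using that add[of "r - 1 - i" "r - 1"] diff_le_mono2[of 1 "Suc i" r] by (simp add: nth)
      qed
    qed (simp add: l_def)
    moreover have "beta_num l k = xs ! k" if "k < r" for k
      using that ge[of k] by (simp add: beta_num_def nth) (simp add: l_def)
    then have "beta_num l ` {..<r} = S"
      using xs by (auto simp: in_set_conv_nth image_iff)
    ultimately show "S \<in> (\<lambda>l. beta_num l ` {..<r}) ` partitions_in_rect s r" by blast
  qed
qed

section \<open>Laplace expansion along a block of rows\<close>

lemma permutes_image_eq_iff:
  assumes p: "p permutes {0..<n}" and "r \<le> n" and S: "S \<subseteq> {..<n}" "card S = r"
  shows "p ` {..<r} = S \<longleftrightarrow> (\<forall>i<n. i < r \<longleftrightarrow> p i \<in> S)"
proof
  have inj: "inj p" by (rule permutes_inj[OF p])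
  show "\<forall>i<n. i < r \<longleftrightarrow> p i \<in> S" if "p ` {..<r} = S"
    using that inj_image_mem_iff[OF inj, of _ "{..<r}"] by auto
  show "p ` {..<r} = S" if *: "\<forall>i<n. i < r \<longleftrightarrow> p i \<in> S"
  proof (rule card_subset_eq)
    show "finite S" using S finite_subset by blast
    show "p ` {..<r} \<subseteq> S" using * \<open>r \<le> n\<close> by (auto dest: less_le_trans)
    show "card (p ` {..<r}) = card S"
      using S inj by (simp add: card_image inj_on_subset)
  qed
qed

text \<open>
  The matrix \<open>N\<close> keeps the upper block in the columns of \<open>S\<close> and the lower block in the others.  The shuffle
  permutation of the columns makes it block diagonal.
\<close>

lemma det_block_supported:
  fixes A B :: "'a::idom mat"
  assumes A: "A \<in> carrier_mat r (r + s)" and B: "B \<in> carrier_mat s (r + s)"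
    and l: "l \<in> partitions_in_rect s r"
  defines "S \<equiv> beta_num l ` {..<r}"
  defines "N \<equiv> mat (r + s) (r + s) (\<lambda>(i, j). if i < r \<longleftrightarrow> j \<in> S then (A @\<^sub>r B) $$ (i, j) else 0)"
  shows "Determinant.det N = (-1) ^ sum_list l *
    Determinant.det (mat r r (\<lambda>(i, j). A $$ (i, beta_num l j))) *
    Determinant.det (mat s s (\<lambda>(i, j). B $$ (i, beta_num (dual_partition s r l) j)))"
proof -
  let ?w = "shuffle_perm s r l"
  let ?A = "mat r r (\<lambda>(i, j). A $$ (i, beta_num l j))"
  let ?B = "mat s s (\<lambda>(i, j). B $$ (i, beta_num (dual_partition s r l) j))"
  let ?F = "four_block_mat ?A (0\<^sub>m r s) (0\<^sub>m s r) ?B"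
  note w = shuffle_perm_permutes[OF l]
  have lt: "?w j < r + s" if "j < r + s" for j using permutes_in_image[OF w, of j] that by simp
  have S: "?w j \<in> S \<longleftrightarrow> j < r" if "j < r + s" for j
  proof -
    have "S = ?w ` {..<r}" by (auto simp: S_def shuffle_perm_def)
    then show ?thesis using inj_image_mem_iff[OF permutes_inj[OF w], of j "{..<r}"] by simp
  qed
  have "mat (r + s) (r + s) (\<lambda>(i, j). transpose_mat N $$ (?w i, j)) = transpose_mat ?F"
  proof (rule eq_matI)
    fix i j assume "i < dim_row (transpose_mat ?F)" "j < dim_col (transpose_mat ?F)"
    then have ij: "i < r + s" "j < r + s" by auto
    then show "mat (r + s) (r + s) (\<lambda>(i, j). transpose_mat N $$ (?w i, j)) $$ (i, j)
        = transpose_mat ?F $$ (i, j)"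
      using A B lt[OF ij(1)] S[OF ij(1)]
      by (auto simp: N_def append_rows_def shuffle_perm_def)
  qed auto
  then have "Determinant.det (transpose_mat ?F) = of_int (sign ?w) * Determinant.det (transpose_mat N)"
    using det_permute_rows[OF _ w, of "transpose_mat N"] by (simp add: N_def)
  then have "Determinant.det ?F = of_int (sign ?w) * Determinant.det N"
    by (simp add: N_def det_transpose[of _ "r + s"])
  moreover have "Determinant.det ?F = Determinant.det ?A * Determinant.det ?B"
    by (rule det_four_block_mat_upper_right_zero) auto
  ultimately have "Determinant.det ?A * Determinant.det ?B = (-1) ^ sum_list l * Determinant.det N"
    by (simp add: sign_shuffle_perm[OF l])
  then have "(-1) ^ sum_list l * (Determinant.det ?A * Determinant.det ?B)
      = ((-1) ^ sum_list l * (-1) ^ sum_list l) * Determinant.det N"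
    by (simp add: mult.assoc)
  then show ?thesis by (simp add: mult.assoc flip: power_mult_distrib)
qed

text \<open>
  The permutations in the Leibniz formula are grouped by the set of columns that they assign to the upper
  rows.  The group of a set \<open>S\<close> consists of the terms that survive in the matrix supported on \<open>S\<close>.
\<close>

theorem laplace_expansion_rows:
  fixes A B :: "'a::idom mat"
  assumes A: "A \<in> carrier_mat r (r + s)" and B: "B \<in> carrier_mat s (r + s)"
  shows "Determinant.det (A @\<^sub>r B) = (\<Sum>l\<in>partitions_in_rect s r. (-1) ^ sum_list l *
    Determinant.det (mat r r (\<lambda>(i, j). A $$ (i, beta_num l j))) *
    Determinant.det (mat s s (\<lambda>(i, j). B $$ (i, beta_num (dual_partition s r l) j))))"
proof -
  let ?n = "r + s" and ?M = "A @\<^sub>r B"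
  let ?P = "{p. p permutes {0..<?n}}" and ?T = "{S. S \<subseteq> {..<?n} \<and> card S = r}"
  let ?h = "\<lambda>p. of_int (sign p) * (\<Prod>i = 0..<?n. ?M $$ (i, p i))"
  let ?N = "\<lambda>S. mat ?n ?n (\<lambda>(i, j). if i < r \<longleftrightarrow> j \<in> S then ?M $$ (i, j) else 0)"
  have M: "?M \<in> carrier_mat ?n ?n" using A B by auto
  have fP: "finite ?P" by (rule finite_permutations) simp
  have fT: "finite ?T" by (rule finite_subset[of _ "Pow {..<?n}"]) auto
  have N: "Determinant.det (?N S) = sum ?h {p \<in> ?P. p ` {..<r} = S}" if S: "S \<in> ?T" for S
  proof -
    have "Determinant.det (?N S)
        = (\<Sum>p\<in>?P. of_int (sign p) * (\<Prod>i = 0..<?n. ?N S $$ (i, p i)))"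
      by (rule det_def'[OF mat_carrier])
    also have "\<dots> = (\<Sum>p\<in>?P. if p ` {..<r} = S then ?h p else 0)"
    proof (rule sum.cong[OF refl])
      fix p assume "p \<in> ?P"
      then have p: "p permutes {0..<?n}" by simp
      have lt: "p i < ?n" if "i < ?n" for i using permutes_in_image[OF p, of i] that by simp
      have iff: "p ` {..<r} = S \<longleftrightarrow> (\<forall>i<?n. i < r \<longleftrightarrow> p i \<in> S)"
        by (rule permutes_image_eq_iff[OF p]) (use S in auto)
      show "of_int (sign p) * (\<Prod>i = 0..<?n. ?N S $$ (i, p i))
          = (if p ` {..<r} = S then ?h p else 0)"
      proof (cases "p ` {..<r} = S")
        case True
        then have *: "i < r \<longleftrightarrow> p i \<in> S" if "i < ?n" for i using that iff by simp
        have "(\<Prod>i = 0..<?n. ?N S $$ (i, p i)) = (\<Prod>i = 0..<?n. ?M $$ (i, p i))"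
          by (rule prod.cong[OF refl]) (use lt * in auto)
        with True show ?thesis by simp
      next
        case False
        with iff obtain i where i: "i < ?n" "\<not> (i < r \<longleftrightarrow> p i \<in> S)" by auto
        then have "?N S $$ (i, p i) = 0" using lt by auto
        then have "(\<Prod>i = 0..<?n. ?N S $$ (i, p i)) = 0" using i(1) by (intro prod_zero) auto
        with False show ?thesis by simp
      qed
    qed
    also have "\<dots> = sum ?h {p \<in> ?P. p ` {..<r} = S}"
      by (rule sum.inter_filter[OF fP, symmetric])
    finally show ?thesis .
  qed
  have "(\<lambda>p. p ` {..<r}) ` ?P \<subseteq> ?T"
  proof safe
    fix p assume p: "p permutes {0..<?n}"
    show "p k < ?n" if "k < r" for k using permutes_in_image[OF p, of k] that by simp
    show "card (p ` {..<r}) = r" using permutes_inj[OF p] by (simp add: card_image inj_on_subset)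
  qed
  then have "Determinant.det ?M = (\<Sum>S\<in>?T. sum ?h {p \<in> ?P. p ` {..<r} = S})"
    using sum.group[OF fP fT, of "\<lambda>p. p ` {..<r}" ?h] by (simp add: det_def'[OF M])
  also have "\<dots> = (\<Sum>S\<in>?T. Determinant.det (?N S))" by (intro sum.cong) (auto simp: N)
  also have "\<dots> = (\<Sum>l\<in>partitions_in_rect s r. Determinant.det (?N (beta_num l ` {..<r})))"
    by (rule sum.reindex_bij_betw[OF bij_betw_partitions_subsets, symmetric])
  also have "\<dots> = (\<Sum>l\<in>partitions_in_rect s r. (-1) ^ sum_list l *
    Determinant.det (mat r r (\<lambda>(i, j). A $$ (i, beta_num l j))) *
    Determinant.det (mat s s (\<lambda>(i, j). B $$ (i, beta_num (dual_partition s r l) j))))"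
    by (rule sum.cong[OF refl]) (rule det_block_supported[OF A B])
  finally show ?thesis .
qed

section \<open>Passage to the limit\<close>

text \<open>
  Reversing the rows and reversing the columns contribute the same sign.
\<close>

lemma det_reverse:
  fixes g :: "nat \<Rightarrow> nat \<Rightarrow> 'a::comm_ring_1"
  shows "Determinant.det (mat n n (\<lambda>(i, j). g (n - 1 - i) (n - 1 - j))) = Determinant.det (mat n n (\<lambda>(i, j). g j i))"
proof -
  define p where "p = (\<lambda>i. if i < n then n - 1 - i else i)"
  have p: "p permutes {0..<n}"
    by (rule bij_imp_permutes, rule bij_betw_byWitness[where f' = p]) (auto simp: p_def)
  have [simp]: "p i < n" "p i = n - 1 - i" if "i < n" for i using that by (auto simp: p_def)
  let ?G = "mat n n (\<lambda>(i, j). g i j)" and ?H = "mat n n (\<lambda>(i, j). g (n - 1 - i) j)"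
  have "?H = mat n n (\<lambda>(i, j). ?G $$ (p i, j))" by (intro eq_matI) auto
  then have 1: "Determinant.det ?H = of_int (sign p) * Determinant.det ?G"
    using det_permute_rows[OF _ p, of ?G] by simp
  have "mat n n (\<lambda>(i, j). g (n - 1 - j) (n - 1 - i)) = mat n n (\<lambda>(i, j). transpose_mat ?H $$ (p i, j))"
    by (intro eq_matI) auto
  then have 2: "Determinant.det (mat n n (\<lambda>(i, j). g (n - 1 - j) (n - 1 - i)))
      = of_int (sign p) * Determinant.det ?H"
    using det_permute_rows[OF _ p, of "transpose_mat ?H"] det_transpose[of ?H n] by simp
  have tr: "Determinant.det (mat n n (\<lambda>(i, j). f j i)) = Determinant.det (mat n n (\<lambda>(i, j). f i j))"
    for f :: "nat \<Rightarrow> nat \<Rightarrow> 'a"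
  proof -
    have "mat n n (\<lambda>(i, j). f j i) = transpose_mat (mat n n (\<lambda>(i, j). f i j))"
      by (intro eq_matI) auto
    then show ?thesis by (simp add: det_transpose[of _ n])
  qed
  have "of_int (sign p) * (of_int (sign p) * c) = c" for c :: 'a
    by (simp flip: of_int_mult mult.assoc)
  with 1 2 show ?thesis
    by (simp only: tr[of g] tr[of "\<lambda>i j. g (n - 1 - i) (n - 1 - j)"])
qed

lemma tendsto_det:
  fixes f :: "'b \<Rightarrow> nat \<Rightarrow> nat \<Rightarrow> complex"
  assumes "\<And>i j. i < n \<Longrightarrow> j < n \<Longrightarrow> ((\<lambda>N. f N i j) \<longlongrightarrow> g i j) F"
  shows "((\<lambda>N. Determinant.det (mat n n (\<lambda>(i, j). f N i j)))
    \<longlongrightarrow> Determinant.det (mat n n (\<lambda>(i, j). g i j))) F"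
proof -
  have eq: "Determinant.det (mat n n (\<lambda>(i, j). h i j))
      = (\<Sum>p | p permutes {0..<n}. of_int (sign p) * (\<Prod>i = 0..<n. h i (p i)))"
    for h :: "nat \<Rightarrow> nat \<Rightarrow> complex"
    unfolding det_def'[OF mat_carrier]
    by (intro sum.cong refl arg_cong2[of _ _ _ _ "(*)"] prod.cong) (auto dest: permutes_in_image)
  show ?thesis unfolding eq
    by (intro tendsto_sum tendsto_mult tendsto_const tendsto_prod assms)
       (auto dest: permutes_in_image)
qed

lemma tendsto_infsum_exhaustion:
  fixes f :: "'a \<Rightarrow> 'b::{comm_monoid_add, t2_space}"
  assumes "f summable_on A" and fin: "\<And>N. finite (B N)" and sub: "\<And>N. B N \<subseteq> A"
    and mono: "\<And>M N. M \<le> N \<Longrightarrow> B M \<subseteq> B N" and ex: "\<And>x. x \<in> A \<Longrightarrow> \<exists>N. x \<in> B N"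
  shows "(\<lambda>N::nat. sum f (B N)) \<longlonglongrightarrow> infsum f A"
proof -
  have "filterlim B (finite_subsets_at_top A) sequentially"
    unfolding filterlim_finite_subsets_at_top
  proof (intro allI impI)
    fix X assume X: "finite X \<and> X \<subseteq> A"
    have "\<exists>N. \<forall>M\<ge>N. X \<subseteq> B M"
      using conjunct1[OF X] conjunct2[OF X]
    proof (induction X)
      case (insert x X)
      from insert obtain N1 where "\<forall>M\<ge>N1. X \<subseteq> B M" by auto
      moreover obtain N2 where "x \<in> B N2" using ex[of x] insert.prems by auto
      moreover note N = calculation
      have "insert x X \<subseteq> B M" if "M \<ge> max N1 N2" for M
        using N mono[of N2 M] that by auto
      then show ?case by blast
    qed auto
    then show "\<forall>\<^sub>F N in sequentially. finite (B N) \<and> X \<subseteq> B N \<and> B N \<subseteq> A"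
      using fin sub by (auto simp: eventually_sequentially)
  qed
  with infsum_tendsto[OF assms(1)] show ?thesis by (rule filterlim_compose)
qed

lemma abs_summable_nat_powr:
  assumes "Re s > 1"
  shows "Infinite_Set_Sum.abs_summable_on (\<lambda>m::nat. of_nat m powr (- s) :: complex) UNIV"
proof -
  have "summable (\<lambda>m::nat. real m powr - Re s)" using assms by (simp add: summable_real_powr_iff)
  then show ?thesis by (simp add: abs_summable_on_nat_iff' norm_powr_real_powr)
qed

text \<open>
  The sum of the absolute values factors into convergent zeta series.  The series over tableaux and over
  sorted lists run over subsets of this index set (up to a bijection).
\<close>

lemma summable_on_prod_powr:
  assumes "finite D" and "\<And>p. p \<in> D \<Longrightarrow> Re (t p) > 1"
  shows "(\<lambda>m. \<Prod>p\<in>D. of_nat (m p) powr (- t p) :: complex) summable_on (\<Pi>\<^sub>E p\<in>D. UNIV :: nat set)"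
proof -
  have "Infinite_Set_Sum.abs_summable_on
      (\<lambda>m. \<Prod>p\<in>D. of_nat (m p) powr (- t p) :: complex) (\<Pi>\<^sub>E p\<in>D. UNIV :: nat set)"
    by (rule abs_summable_on_prod_PiE) (use assms abs_summable_nat_powr in auto)
  then show ?thesis
    unfolding abs_summable_equivalent[symmetric] by (rule abs_summable_summable)
qed

lemma zeta_star_tendsto:
  assumes "\<And>s. s \<in> set ss \<Longrightarrow> Re s > 1"
  shows "(\<lambda>N. \<Sum>ms\<in>star_seqs (length ss) N. \<Prod>i<length ss. of_nat (ms ! i) powr (- (ss ! i)))
    \<longlonglongrightarrow> zeta_star ss"
  unfolding zeta_star_def
proof (rule tendsto_infsum_exhaustion)
  let ?n = "length ss" and ?f = "\<lambda>ms. \<Prod>i<length ss. of_nat (ms ! i) powr (- (ss ! i)) :: complex"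
  have bij: "bij_betw (\<lambda>g. map g [0..<?n]) (\<Pi>\<^sub>E i\<in>{..<?n}. UNIV :: nat set) {ms. length ms = ?n}"
  proof (rule bij_betw_byWitness[where f' = "\<lambda>ms. \<lambda>i\<in>{..<?n}. ms ! i"])
    show "\<forall>g\<in>\<Pi>\<^sub>E i\<in>{..<?n}. UNIV :: nat set. (\<lambda>i\<in>{..<?n}. map g [0..<?n] ! i) = g"
    proof (intro ballI ext)
      fix g i assume g: "g \<in> (\<Pi>\<^sub>E i\<in>{..<?n}. UNIV :: nat set)"
      show "(\<lambda>i\<in>{..<?n}. map g [0..<?n] ! i) i = g i"
        using PiE_arb[OF g, of i] by (cases "i < ?n") auto
    qed
    show "\<forall>ms\<in>{ms. length ms = ?n}. map (\<lambda>i\<in>{..<?n}. ms ! i) [0..<?n] = ms"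
      by (auto intro: nth_equalityI)
    show "(\<lambda>g. map g [0..<?n]) ` (\<Pi>\<^sub>E i\<in>{..<?n}. UNIV :: nat set) \<subseteq> {ms. length ms = ?n}"
      by (intro image_subsetI) simp
    show "(\<lambda>ms. \<lambda>i\<in>{..<?n}. ms ! i) ` {ms. length ms = ?n} \<subseteq> (\<Pi>\<^sub>E i\<in>{..<?n}. UNIV :: nat set)"
      by (intro image_subsetI, rule restrict_PiE_iff[THEN iffD2]) blast
  qed
  have "(\<lambda>g. \<Prod>i<?n. of_nat (g i) powr (- (ss ! i)) :: complex) summable_on (\<Pi>\<^sub>E i\<in>{..<?n}. UNIV)"
    by (rule summable_on_prod_powr) (use assms in auto)
  then have "(\<lambda>g. ?f (map g [0..<?n])) summable_on (\<Pi>\<^sub>E i\<in>{..<?n}. UNIV :: nat set)"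
    by (rule summable_on_cong[THEN iffD1, rotated]) simp
  then have "?f summable_on {ms. length ms = ?n}"
    using summable_on_reindex_bij_betw[OF bij, of ?f] by simp
  then show "?f summable_on {ms. length ms = ?n \<and> (\<forall>m\<in>set ms. 0 < m) \<and> sorted ms}"
    by (rule summable_on_subset_banach) auto
  show "\<exists>N. ms \<in> star_seqs ?n N" if "ms \<in> {ms. length ms = ?n \<and> (\<forall>m\<in>set ms. 0 < m) \<and> sorted ms}" for ms
    using that by (intro exI[of _ "sum_list ms"]) (auto simp: star_seqs_def member_le_sum_list)
qed (use finite_star_seqs in \<open>auto simp: star_seqs_def\<close>)

lemma schur_zeta_tendsto:
  assumes "\<And>p. p \<in> diagram l \<Longrightarrow> Re (t p) > 1"
  shows "(\<lambda>N. \<Sum>m\<in>flagged_SSYT l (\<lambda>_. N). \<Prod>p\<in>diagram l. of_nat (m p) powr (- t p))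
    \<longlonglongrightarrow> schur_zeta l t"
  unfolding schur_zeta_def
proof (rule tendsto_infsum_exhaustion)
  show "(\<lambda>m. \<Prod>p\<in>diagram l. of_nat (m p) powr (- t p) :: complex) summable_on SSYT l"
    by (rule summable_on_subset_banach[OF summable_on_prod_powr[OF finite_diagram assms]])
       (auto simp: SSYT_def fillings_def)
  show "\<exists>N. m \<in> flagged_SSYT l (\<lambda>_. N)" if m: "m \<in> SSYT l" for m
  proof (intro exI flagged_SSYT_I[OF m])
    fix i j assume "(i, j) \<in> diagram l"
    then show "m (i, j) \<le> sum m (diagram l)" by (intro member_le_sum) (auto simp: finite_diagram)
  qed
  show "flagged_SSYT l (\<lambda>_. M) \<subseteq> flagged_SSYT l (\<lambda>_. N)" if "M \<le> N" for M N
    using that by (blast intro: flagged_SSYT_I order_trans flagged_SSYT_D)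
qed (auto simp: finite_flagged_SSYT dest: flagged_SSYT_D)

text \<open>
  Row \<open>i\<close> of a block with \<open>r\<close> rows starts at the content \<open>i + 1 - r\<close>, which is minus the index of the row
  counted from the bottom.
\<close>

lemma block_entry_tendsto:
  assumes "\<And>k. - int r < k \<Longrightarrow> k < int s \<Longrightarrow> Re (c k) > 1" and i: "i < r" and j: "j < r + s"
  shows "(\<lambda>N. star_sum (\<lambda>k m. of_nat m powr (- c k)) N (- int (r - 1 - i)) (int j + 1 - int r))
    \<longlonglongrightarrow> block_entry r c (i + 1) (j + 1)"
proof -
  have lo: "- int (r - 1 - i) = int i + 1 - int r" using i by simp
  show ?thesis
  proof (cases "i < j")
    case False
    then show ?thesis
      unfolding lo by (cases "i = j") (simp_all add: block_entry_def star_sum_less)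
  next
    case True
    define ss where "ss = map c [int i + 1 - int r..int j - int r]"
    have len: "length ss = j - i" using True by (simp add: ss_def)
    have nth: "ss ! k = c (int i + 1 - int r + int k)" if "k < j - i" for k
      using that True by (simp add: ss_def)
    have "(\<lambda>N. \<Sum>ms\<in>star_seqs (length ss) N. \<Prod>k<length ss. of_nat (ms ! k) powr (- (ss ! k)))
        \<longlonglongrightarrow> zeta_star ss"
      by (rule zeta_star_tendsto) (use i j assms(1) in \<open>auto simp: ss_def\<close>)
    also have "(\<lambda>N. \<Sum>ms\<in>star_seqs (length ss) N. \<Prod>k<length ss. of_nat (ms ! k) powr (- (ss ! k)))
      = (\<lambda>N. star_sum (\<lambda>k m. of_nat m powr (- c k)) N (- int (r - 1 - i)) (int j + 1 - int r))"
    proof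
      fix N
      have "nat (int j + 1 - int r - (int i + 1 - int r)) = j - i" using True by simp
      moreover have "\<not> int j + 1 - int r < int i + 1 - int r" using True by simp
      ultimately show "(\<Sum>ms\<in>star_seqs (length ss) N. \<Prod>k<length ss. of_nat (ms ! k) powr (- (ss ! k)))
        = star_sum (\<lambda>k m. of_nat m powr (- c k)) N (- int (r - 1 - i)) (int j + 1 - int r)"
        unfolding star_sum_def lo len by (simp add: nth)
    qed
    also have "zeta_star ss = block_entry r c (i + 1) (j + 1)"
      using True by (simp add: block_entry_def ss_def algebra_simps)
    finally show ?thesis .
  qed
qed

text \<open>
  The minors of the blocks list the rows of the tableau from bottom to top and are transposed compared with
  \<open>flagged_jacobi_trudi\<close>, which \<open>det_reverse\<close> accounts for.
\<close>

theorem schur_zeta_jacobi_trudi: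
  assumes l: "l \<in> partitions_in_rect s r"
    and t: "\<And>i j. (i, j) \<in> diagram l \<Longrightarrow> t (i, j) = c (int j - int i)"
    and conv: "\<And>k. - int r < k \<Longrightarrow> k < int s \<Longrightarrow> Re (c k) > 1"
  shows "schur_zeta l t
    = Determinant.det (mat r r (\<lambda>(i, j). block_entry r c (i + 1) (beta_num l j + 1)))"
proof -
  let ?x = "\<lambda>k m. of_nat m powr (- c k) :: complex"
  note D = partitions_in_rect_D[OF l]
  have content: "Re (t p) > 1" if "p \<in> diagram l" for p
  proof (cases p)
    case (Pair i j)
    then have "1 \<le> i" "i \<le> r" "1 \<le> j" "j \<le> l ! (i - 1)" "l ! (i - 1) \<le> s"
      using that D(1) D(3)[of "i - 1"] by (auto simp: diagram_def)
    then show ?thesis using t[of i j] that conv[of "int j - int i"] Pair by auto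
  qed
  have "flagged_schur ?x l (\<lambda>_. N) = Determinant.det (mat r r
      (\<lambda>(i, j). star_sum ?x N (- int (r - 1 - i)) (int (beta_num l j) + 1 - int r)))" for N
  proof -
    let ?g = "\<lambda>i j. star_sum ?x N (- int i) (int (l ! j) - int j)"
    have "flagged_schur ?x l (\<lambda>_. N) = Determinant.det (mat r r (\<lambda>(i, j). ?g j i))"
      using flagged_jacobi_trudi[of l "\<lambda>_. N" ?x] l by (simp add: partitions_in_rect_def mono_def)
    also have "\<dots> = Determinant.det (mat r r (\<lambda>(i, j). ?g (r - 1 - i) (r - 1 - j)))"
      by (rule det_reverse[symmetric])
    also have "mat r r (\<lambda>(i, j). ?g (r - 1 - i) (r - 1 - j)) = mat r r
      (\<lambda>(i, j). star_sum ?x N (- int (r - 1 - i)) (int (beta_num l j) + 1 - int r))"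
    proof (rule cong_mat[OF refl refl])
      fix i j assume "j < r"
      then have "int (l ! (r - 1 - j)) - int (r - 1 - j) = int (beta_num l j) + 1 - int r"
        by (simp add: beta_num_def D(1))
      then show "(\<lambda>(i, j). ?g (r - 1 - i) (r - 1 - j)) (i, j)
        = (\<lambda>(i, j). star_sum ?x N (- int (r - 1 - i)) (int (beta_num l j) + 1 - int r)) (i, j)"
        by simp
    qed
    finally show ?thesis .
  qed
  moreover have "flagged_schur ?x l (\<lambda>_. N)
      = (\<Sum>m\<in>flagged_SSYT l (\<lambda>_. N). \<Prod>p\<in>diagram l. of_nat (m p) powr (- t p))" for N
    unfolding flagged_schur_def by (intro sum.cong prod.cong) (auto simp: t)
  ultimately have "(\<lambda>N. Determinant.det (mat r r
      (\<lambda>(i, j). star_sum ?x N (- int (r - 1 - i)) (int (beta_num l j) + 1 - int r))))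
      \<longlonglongrightarrow> schur_zeta l t"
    using schur_zeta_tendsto[of l t, OF content] by simp
  moreover have "(\<lambda>N. Determinant.det (mat r r
      (\<lambda>(i, j). star_sum ?x N (- int (r - 1 - i)) (int (beta_num l j) + 1 - int r))))
      \<longlonglongrightarrow> Determinant.det (mat r r (\<lambda>(i, j). block_entry r c (i + 1) (beta_num l j + 1)))"
    by (rule tendsto_det) (rule block_entry_tendsto[OF conv _ beta_num_less[OF l]])
  ultimately show ?thesis by (rule LIMSEQ_unique)
qed

lemma diagram_subset_rect:
  assumes "l \<in> partitions_in_rect s r"
  shows "diagram l \<subseteq> diagram (rect s r)"
proof safe
  fix i j assume "(i, j) \<in> diagram l"
  then have "1 \<le> i" "i \<le> r" "1 \<le> j" "j \<le> l ! (i - 1)"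
    using partitions_in_rect_D(1)[OF assms] by (auto simp: diagram_def)
  moreover from this have "l ! (i - 1) \<le> s" by (intro partitions_in_rect_D(3)[OF assms]) simp
  ultimately show "(i, j) \<in> diagram (rect s r)"
    by (simp add: diagram_def rect_def)
qed

text \<open>
  Every content of the rectangle occurs in its first row or its first column.
\<close>

lemma content_in_rect:
  assumes "0 < r" "0 < s" "- int r < k" "k < int s"
  obtains i j where "1 \<le> i" "i \<le> r" "1 \<le> j" "j \<le> s" "k = int j - int i"
proof (cases "k \<ge> 0")
  case True
  with assms show ?thesis by (intro that[of 1 "nat (k + 1)"]) auto
next
  case False
  with assms show ?thesis by (intro that[of "nat (1 - k)" 1]) auto
qed

lemma schur_zeta_restrict_jacobi_trudi:
  assumes "0 < r" "0 < s" and l: "l \<in> partitions_in_rect s r"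
    and c: "\<And>i j. (i, j) \<in> diagram (rect s r) \<Longrightarrow> c (int j - int i) = t (i, j)"
    and conv: "\<And>i j. 1 \<le> i \<Longrightarrow> i \<le> r \<Longrightarrow> 1 \<le> j \<Longrightarrow> j \<le> s \<Longrightarrow> Re (t (i, j)) > 1"
  shows "schur_zeta l (restrict t (diagram l))
    = Determinant.det (mat r r (\<lambda>(i, j). block_entry r c (i + 1) (beta_num l j + 1)))"
proof (rule schur_zeta_jacobi_trudi[OF l])
  show "restrict t (diagram l) (i, j) = c (int j - int i)" if "(i, j) \<in> diagram l" for i j
    using that c[of i j] diagram_subset_rect[OF l] by auto
  show "Re (c k) > 1" if k: "- int r < k" "k < int s" for k
  proof -
    obtain i j where ij: "1 \<le> i" "i \<le> r" "1 \<le> j" "j \<le> s" "k = int j - int i"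
      by (rule content_in_rect[OF assms(1,2) k])
    moreover from this have "(i, j) \<in> diagram (rect s r)" by (auto simp: diagram_def rect_def)
    ultimately show ?thesis using c[of i j] conv[of i j] by simp
  qed
qed

theorem theorem4p8:
  fixes r s \<eta> :: nat
    and \<sigma> \<tau> :: "nat \<times> nat \<Rightarrow> complex"
    and a b :: "int \<Rightarrow> complex"
  assumes "r > 0" and "s > 0" and "\<eta> = r + s"
    and "\<sigma> \<in> W_diag (rect s r)"
    and "\<tau> \<in> W_diag (rect r s)"
    and "\<And>i j. (i, j) \<in> diagram (rect s r) \<Longrightarrow> a (int j - int i) = \<sigma> (i, j)"
    and "\<And>i j. (i, j) \<in> diagram (rect r s) \<Longrightarrow> b (int j - int i) = \<tau> (i, j)"
    and "\<And>i j. 1 \<le> i \<Longrightarrow> i \<le> r \<Longrightarrow> 1 \<le> j \<Longrightarrow> j \<le> s \<Longrightarrow> Re (\<sigma> (i, j)) > 1"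
    and "\<And>i j. 1 \<le> i \<Longrightarrow> i \<le> s \<Longrightarrow> 1 \<le> j \<Longrightarrow> j \<le> r \<Longrightarrow> Re (\<tau> (i, j)) > 1"
  shows "(\<Sum>l\<in>partitions_in_rect s r.
            (-1) ^ sum_list l
            * schur_zeta l (restrict \<sigma> (diagram l))
            * schur_zeta (dual_partition s r l) (restrict \<tau> (diagram (dual_partition s r l))))
         = Determinant.det (block r \<eta> a @\<^sub>r block s \<eta> b)"
proof -
  have minor: "mat p p (\<lambda>(i, j). block p (r + s) c $$ (i, beta_num l j))
      = mat p p (\<lambda>(i, j). block_entry p c (i + 1) (beta_num l j + 1))"
    if "l \<in> partitions_in_rect q p" "p + q = r + s" for p q l c
    using beta_num_less[OF that(1)] that(2) by (intro cong_mat) (auto simp: block_def)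
  have "Determinant.det (block r \<eta> a @\<^sub>r block s \<eta> b) = (\<Sum>l\<in>partitions_in_rect s r. (-1) ^ sum_list l *
    Determinant.det (mat r r (\<lambda>(i, j). block r \<eta> a $$ (i, beta_num l j))) *
    Determinant.det (mat s s (\<lambda>(i, j). block s \<eta> b $$ (i, beta_num (dual_partition s r l) j))))"
    by (rule laplace_expansion_rows) (auto simp: block_def assms(3))
  also have "\<dots> = (\<Sum>l\<in>partitions_in_rect s r.
            (-1) ^ sum_list l
            * schur_zeta l (restrict \<sigma> (diagram l))
            * schur_zeta (dual_partition s r l) (restrict \<tau> (diagram (dual_partition s r l))))"
  proof (rule sum.cong[OF refl])
    fix l assume l: "l \<in> partitions_in_rect s r"
    note d = dual_partition_in_rect[of s r l]
    have zeta_l: "schur_zeta l (restrict \<sigma> (diagram l))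
      = Determinant.det (mat r r (\<lambda>(i, j). block_entry r a (i + 1) (beta_num l j + 1)))"
      by (rule schur_zeta_restrict_jacobi_trudi[OF assms(1,2) l]) (use assms(6,8) in auto)
    have zeta_d: "schur_zeta (dual_partition s r l) (restrict \<tau> (diagram (dual_partition s r l)))
      = Determinant.det (mat s s (\<lambda>(i, j). block_entry s b (i + 1) (beta_num (dual_partition s r l) j + 1)))"
      by (rule schur_zeta_restrict_jacobi_trudi[OF assms(2,1) d]) (use assms(7,9) in auto)
    show "(-1) ^ sum_list l *
      Determinant.det (mat r r (\<lambda>(i, j). block r \<eta> a $$ (i, beta_num l j))) *
      Determinant.det (mat s s (\<lambda>(i, j). block s \<eta> b $$ (i, beta_num (dual_partition s r l) j)))
      = (-1) ^ sum_list l
            * schur_zeta l (restrict \<sigma> (diagram l))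
            * schur_zeta (dual_partition s r l) (restrict \<tau> (diagram (dual_partition s r l)))"
      unfolding assms(3) minor[OF l refl] minor[OF d add.commute] zeta_l zeta_d ..
  qed
  finally show ?thesis ..
qed

end
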